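(* Let $v$ be a positive integer, $n=v-3$, and write $\binom{v-3}{2}_2=\frac{(2^{v-3}-1)(2^{v-4}-1)}{3}$ for the number of $2$-dimensional subspaces of $\mathbb{F}_2^{v-3}$. (i) If $v\equiv 7\pmod 8$, then there exist a $3$-dimensional $\mathbb{F}_2$-subspace $W$ of $\mathbb{F}_{2^n}$ and a $(v,M,4;3)_2$ subspace code with ambient space $V=W\times\mathbb{F}_{2^n}$ that is invariant under $\Sigma_v$ and satisfies $$M\ \ge\ 2^{2(v-3)}+\tfrac{9}{8}\binom{v-3}{2}_2 .$$ Consequently $A_2(v,4;3)\ge 2^{2(v-3)}+\frac98\binom{v-3}{2}_2$. (ii) If $v\equiv 3\pmod 8$ and $v\ge 11$, then there exist a $3$-dimensional $\mathbb{F}_2$-subspace $W$ of $\mathbb{F}_{2^n}$ and a $(v,M,4;3)_2$ subspace code with ambient space $V=W\times\mathbb{F}_{2^n}$ that is invariant under $\Sigma_v$ and satisfies $$M\ \ge\ 2^{2(v-3)}+\tfrac{81}{64}\binom{v-3}{2}_2 .$$ Consequently $A_2(v,4;3)\ge 2^{2(v-3)}+\frac{81}{64}\binom{v-3}{2}_2$.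
   Context: For subspaces $X,Y$ of a finite-dimensional $\mathbb{F}_2$-vector space $V$, the subspace distance is $d_s(X,Y)=\dim X+\dim Y-2\dim(X\cap Y)$. A $(v,M,d;k)_2$ subspace code with ambient space $V$ ($\dim_{\mathbb{F}_2}V=v$) is a set of $M$ distinct $k$-dimensional $\mathbb{F}_2$-subspaces of $V$ with minimum subspace distance $d$ between distinct members. $A_2(v,d;k)$ is the maximum $M$ for which a $(v,M,d;k)_2$ code exists. For $V=W\times\mathbb{F}_{2^n}$, $\Sigma_v\le\mathrm{GL}(V)$ is the group of all maps $(x,y)\mapsto(x,ry)$ with $r\in\mathbb{F}_{2^n}^\times$. A code $\mathcal{C}$ is $\Sigma_v$-invariant if $g(X)\in\mathcal{C}$ for all $X\in\mathcal{C}$, $g\in\Sigma_v$. *)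

theory Defs
  imports
    Complex_Main
    "HOL-Library.Z2"
    "HOL-Library.Function_Algebras"
    "HOL-Library.Product_Plus"
    "HOL-Algebra.Algebraic_Closure_Type"
    "HOL-Computational_Algebra.Computational_Algebra"
begin

text \<open>
  The field \<open>\<F>\<^sub>2\<close> is the type \<^typ>\<open>bit\<close>. Vector spaces over it are given by their scalar
  multiplication; \<^const>\<open>module.subspace\<close> and \<^const>\<open>vector_space.dim\<close> are the library notions.
\<close>

definition subspace_dist ::
    "(bit \<Rightarrow> 'b::ab_group_add \<Rightarrow> 'b) \<Rightarrow> 'b set \<Rightarrow> 'b set \<Rightarrow> int" where
  "subspace_dist s A B =
     int (vector_space.dim s A) + int (vector_space.dim s B) - 2 * int (vector_space.dim s (A \<inter> B))"

text \<open>
  \<open>is_subspace_code s V v M d k C\<close>: the set \<open>C\<close> is a \<open>(v, M, d; k)\<^sub>2\<close> subspace code with ambient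
  space \<open>V\<close>. The minimum distance is required to be exactly \<open>d\<close>, so \<open>C\<close> has at least two members.
\<close>

definition is_subspace_code ::
    "(bit \<Rightarrow> 'b::ab_group_add \<Rightarrow> 'b) \<Rightarrow> 'b set \<Rightarrow> nat \<Rightarrow> nat \<Rightarrow> nat \<Rightarrow> nat \<Rightarrow> 'b set set \<Rightarrow> bool" where
  "is_subspace_code s V v M d k C \<longleftrightarrow>
     module.subspace s V \<and> finite V \<and> vector_space.dim s V = v \<and>
     (\<forall>A\<in>C. module.subspace s A \<and> A \<subseteq> V \<and> vector_space.dim s A = k) \<and>
     card C = M \<and>
     (\<forall>A\<in>C. \<forall>B\<in>C. A \<noteq> B \<longrightarrow> int d \<le> subspace_dist s A B) \<and>
     (\<exists>A\<in>C. \<exists>B\<in>C. A \<noteq> B \<and> subspace_dist s A B = int d)"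

text \<open>The coordinate space \<open>\<F>\<^sub>2\<^sup>v\<close>, as the functions supported on \<open>{..<v}\<close>.\<close>

definition coord_scale :: "bit \<Rightarrow> (nat \<Rightarrow> bit) \<Rightarrow> (nat \<Rightarrow> bit)" where
  "coord_scale c f = (\<lambda>i. c * f i)"

definition coord_space :: "nat \<Rightarrow> (nat \<Rightarrow> bit) set" where
  "coord_space v = {f. \<forall>i\<ge>v. f i = 0}"

text \<open>
  \<open>A\<^sub>2(v, d; k)\<close>. It depends only on the dimension of the ambient space, which is therefore taken
  to be \<open>\<F>\<^sub>2\<^sup>v\<close>. If there is no code at all with these parameters, the value is unspecified.
\<close>

definition A2 :: "nat \<Rightarrow> nat \<Rightarrow> nat \<Rightarrow> nat" where
  "A2 v d k = Max {M. \<exists>C. is_subspace_code coord_scale (coord_space v) v M d k C}"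

text \<open>
  For \<open>n > 0\<close>, the field \<open>\<F>\<close> with \<open>2\<^sup>n\<close> elements, as the set of roots of \<open>X^(2^n) - X\<close> in
  the algebraic closure of \<open>\<F>\<^sub>2\<close>.
\<close>

definition GF2 :: "nat \<Rightarrow> bit alg_closure set" where
  "GF2 n = {x. x ^ (2 ^ n) = x}"

definition ac_scale :: "bit \<Rightarrow> bit alg_closure \<Rightarrow> bit alg_closure" where
  "ac_scale c x = to_ac c * x"

definition pair_scale ::
    "bit \<Rightarrow> bit alg_closure \<times> bit alg_closure \<Rightarrow> bit alg_closure \<times> bit alg_closure" where
  "pair_scale c p = (ac_scale c (fst p), ac_scale c (snd p))"

text \<open>
  The group \<open>\<Sigma>\<^sub>v\<close> for \<open>V = W \<times> \<F>\<close>, where \<open>\<F>\<close> has \<open>2\<^sup>n\<close> elements. Its members are written as maps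
  on the surrounding type; only their restrictions to \<open>V\<close> matter.
\<close>

definition Sigma_grp ::
    "nat \<Rightarrow> (bit alg_closure \<times> bit alg_closure \<Rightarrow> bit alg_closure \<times> bit alg_closure) set" where
  "Sigma_grp n = {g. \<exists>r \<in> GF2 n - {0}. g = (\<lambda>(x, y). (x, r * y))}"

definition invariant_under :: "('b \<Rightarrow> 'b) set \<Rightarrow> 'b set set \<Rightarrow> bool" where
  "invariant_under G C \<longleftrightarrow> (\<forall>A\<in>C. \<forall>g\<in>G. g ` A \<in> C)"

text \<open>The Gaussian binomial for the number of 2-dimensional subspaces of \<open>\<F>\<^sub>2\<^sup>m\<close>, \<open>m \<ge> 1\<close>.\<close>

definition gauss_binom_2 :: "nat \<Rightarrow> real" where
  "gauss_binom_2 m = (2 ^ m - 1) * (2 ^ (m - 1) - 1) / 3"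

lemma CHAR_bit: "CHAR(bit) = 2"
proof (rule CHAR_eq_posI)
  fix m :: nat assume "0 < m" "m < 2"
  hence "m = 1" by simp
  thus "of_nat m \<noteq> (0 :: bit)" by simp
qed simp_all

lemma CHAR_bit_alg_closure: "CHAR(bit alg_closure) = 2"
  by (simp add: CHAR_bit)

lemma two_bit_alg_closure: "(2 :: bit alg_closure) = 0"
  using of_nat_CHAR[where 'a = "bit alg_closure"] by (simp add: CHAR_bit)

lemma vector_space_coord_scale: "vector_space coord_scale"
  by unfold_locales (auto simp: coord_scale_def fun_eq_iff algebra_simps)

lemma vector_space_ac_scale: "vector_space ac_scale"
  by unfold_locales (auto simp: ac_scale_def algebra_simps two_bit_alg_closure)

lemma vector_space_pair_scale: "vector_space pair_scale"
  by unfold_locales (auto simp: pair_scale_def ac_scale_def algebra_simps two_bit_alg_closure)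

lemma GF2_subfield:
  shows "0 \<in> GF2 n" "1 \<in> GF2 n"
    and "x \<in> GF2 n \<Longrightarrow> y \<in> GF2 n \<Longrightarrow> x + y \<in> GF2 n"
    and "x \<in> GF2 n \<Longrightarrow> - x \<in> GF2 n"
    and "x \<in> GF2 n \<Longrightarrow> y \<in> GF2 n \<Longrightarrow> x * y \<in> GF2 n"
    and "x \<in> GF2 n \<Longrightarrow> inverse x \<in> GF2 n"
proof -
  show "x \<in> GF2 n \<Longrightarrow> y \<in> GF2 n \<Longrightarrow> x + y \<in> GF2 n"
    using freshmans_dream'[where 'a = "bit alg_closure", of "2 ^ n" n x y]
    by (simp add: GF2_def CHAR_bit)
  show "x \<in> GF2 n \<Longrightarrow> - x \<in> GF2 n"
    by (subst uminus_CHAR_2[OF CHAR_bit_alg_closure])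
qed (auto simp: GF2_def power_mult_distrib power_inverse)

lemma card_GF2:
  assumes "n > 0"
  shows "card (GF2 n) = 2 ^ n"
proof -
  define p :: "bit alg_closure poly" where "p = monom 1 (2 ^ n) - monom 1 1"
  have gt: "(2::nat) ^ n > 1"
    using assms by (intro one_less_power) simp_all
  have deg: "degree p = 2 ^ n"
  proof -
    have "degree (- monom 1 1 + monom 1 (2 ^ n) :: bit alg_closure poly) = 2 ^ n"
      by (subst degree_add_eq_right) (use gt in \<open>auto simp: degree_monom_eq\<close>)
    thus ?thesis by (simp add: p_def)
  qed
  hence nz: "p \<noteq> 0" by auto
  have "pderiv p = - 1"
    using assms by (simp add: p_def pderiv_diff pderiv_monom two_bit_alg_closure power_0_left)
  have le1: "order a p \<le> 1" for a
  proof (rule ccontr)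
    assume "\<not> order a p \<le> 1"
    hence "[:- a, 1:] ^ 2 dvd p"
      by (intro dvd_trans[OF le_imp_power_dvd order_1]) simp
    then obtain q where "p = [:- a, 1:] ^ 2 * q" ..
    hence "p = [:- a, 1:] * ([:- a, 1:] * q)" by (simp only: power2_eq_square mult.assoc)
    hence "poly (pderiv p) a = 0"
      by (simp only: pderiv_mult poly_add poly_mult) simp
    with \<open>pderiv p = - 1\<close> show False by simp
  qed
  have roots: "{x. poly p x = 0} = GF2 n"
    by (auto simp: p_def GF2_def poly_monom)
  obtain R where R: "size R = degree p" "p = smult (lead_coeff p) (\<Prod>x\<in>#R. [:- x, 1:])"
    using alg_closed_imp_factorization[OF nz] by blast
  have "proots p = proots (\<Prod>x\<in>#R. [:- x, 1:])"
    by (subst R(2), subst proots_smult) (use nz in auto)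
  also have "\<dots> = R"
  proof (induction R)
    case (add x R)
    have "(\<Prod>y\<in>#R. [:- y, 1:]) \<noteq> 0" by (auto simp: prod_mset_zero_iff)
    with add show ?case by (simp add: proots_mult del: mult_pCons_left)
  qed simp
  finally have R_eq: "R = proots p" by simp
  have "size R = (\<Sum>x\<in>set_mset R. count R x)" by (rule size_multiset_overloaded_eq)
  also have "\<dots> = (\<Sum>x\<in>set_mset R. 1)"
  proof (rule sum.cong)
    fix x assume "x \<in> set_mset R"
    hence "count R x > 0" by simp
    moreover have "count R x \<le> 1" using le1 nz by (simp add: R_eq)
    ultimately show "count R x = 1" by linarith
  qed simp
  also have "\<dots> = card (GF2 n)"
    using nz by (simp add: R_eq roots)
  finally show ?thesis using R(1) deg by simp
qed

end

(*
  Expurgation and augmentation. The graphs over W of the maps x |-> a x + b x^2 form a lifted Gabidulin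
  code with 2^(2n) planes; two of them meet in at most one point since such a map vanishes on at most
  one nonzero x in W. The maps agreeing with a given one, up to multiples of p, on a 2-dimensional
  Z <= W differ from it by (p / delta(Z)) (z^2 x + z x^2) with z in Z, where delta(Z) is the product of
  the nonzero elements of Z. So if the four graphs belonging to a coset of Z are removed, a plane through
  the point p of 0 x F and projecting to Z can be added. The eight maps r ((a + w^2) x + (b + w) x^2),
  w in W, contain two cosets of Z for each of the seven Z: eight removed planes make room for up to
  fourteen new ones. Letting r run through the units of F gives invariance under Sigma_v.

  Everything can be chosen in a subfield E of F: adding to a all elements of an E-complement of E in F
  creates no new coincidences. With E of order 16 one gains 3 * 2^(n-4) (2^n - 1) planes, with E of
  order 256 one gains 54 * 2^(n-8) (2^n - 1).
*)

theory Submission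
  imports Defs
begin

section \<open>Finite vector spaces over the field with two elements\<close>

text \<open>The obstacle is not the exchange at a single Z but the new planes among each other.
  Through a point (0, p) pass new planes for every Z, with r = p / delta(Z), and two of them may
  share a further point over some x. Scaling p to 1 turns this into a finite condition: for each
  nonzero x in W the values over x must be distinct modulo {0, 1}. In E of order 16 there are only 8
  classes for up to 6 values, and 11 of the 14 planes are taken; in E of order 256 there are 128
  classes, enough for nine families of eight maps with all 14 planes each. A surplus of k in E of
  order 2^e gives k * 2^(n-e) * (2^n - 1) extra planes, asymptotically 6k / 2^e times the number of
  lines: k = 11 - 8 gives 18/16 = 9/8, and k = 9 * (14 - 8) gives 324/256 = 81/64. The congruences
  on v make e divide n, so that E lies in F. Passing from E to F is harmless because a coincidence
  is a sum of a part in E and a part in the complement, and both must vanish.\<close>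

lemma bit_subspace_iff:
  fixes s :: "bit \<Rightarrow> 'b::ab_group_add \<Rightarrow> 'b"
  assumes "vector_space s"
  shows "module.subspace s U \<longleftrightarrow> 0 \<in> U \<and> (\<forall>x\<in>U. \<forall>y\<in>U. x + y \<in> U)"
proof -
  interpret vector_space s by fact
  have "s c x \<in> {0, x}" for c x
    by (cases c rule: bit.exhaust) auto
  hence "s c x \<in> U" if "0 \<in> U" "x \<in> U" for c x
    using that by (metis empty_iff insert_iff)
  thus ?thesis
    unfolding subspace_def by blast
qed

text \<open>Adjoining an independent b to B adds the disjoint translate b + span B and so doubles
  the span. With its converse \<open>dim_eqI_card\<close> this reduces the dimensions below to
  counting elements.\<close>

lemma card_eq_two_power_dim:
  fixes s :: "bit \<Rightarrow> 'b::ab_group_add \<Rightarrow> 'b"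
  assumes "vector_space s" "module.subspace s U" "finite U"
  shows "card U = 2 ^ vector_space.dim s U"
proof -
  interpret vector_space s by fact
  have ind: "finite (span B) \<and> card (span B) = 2 ^ card B" if "finite B" "independent B" for B
    using that
  proof (induction B)
    case empty
    show ?case by simp
  next
    case (insert b B)
    have B: "independent B" "b \<notin> span B"
      using insert by (auto simp: independent_insert)
    note IH = insert.IH[OF B(1)]
    have eq: "span (insert b B) = span B \<union> (+) b ` span B"
    proof -
      have "(\<exists>k. x - s k b \<in> span B) \<longleftrightarrow> x \<in> span B \<or> x - b \<in> span B" for x
      proof -
        have "(\<exists>k. P k) \<longleftrightarrow> P 0 \<or> P 1" for P :: "bit \<Rightarrow> bool"
          by (metis bit_not_one_iff)
        thus ?thesis by simp
      qed
      moreover have "x - b \<in> span B \<longleftrightarrow> x \<in> (+) b ` span B" for x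
      proof
        assume "x - b \<in> span B"
        thus "x \<in> (+) b ` span B"
          by (rule rev_image_eqI) simp
      qed auto
      ultimately show ?thesis
        by (auto simp: span_insert)
    qed
    have "span B \<inter> (+) b ` span B = {}"
    proof -
      have False if "x \<in> span B" "b + x \<in> span B" for x
        using span_diff[OF that(2,1)] B(2) by simp
      thus ?thesis by auto
    qed
    hence "card (span (insert b B)) = card (span B) + card ((+) b ` span B)"
      unfolding eq using IH by (intro card_Un_disjoint) auto
    also have "card ((+) b ` span B) = card (span B)"
      by (intro card_image) auto
    finally show ?case
      using IH insert.hyps eq by simp
  qed
  obtain B where B: "B \<subseteq> U" "independent B" "U \<subseteq> span B" "card B = dim U"
    using basis_exists by blast
  have "span B = U"
    using B span_minimal[OF B(1) assms(2)] by blast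
  with ind[of B] B finite_subset[OF B(1) assms(3)] show ?thesis
    by simp
qed

lemma dim_eqI_card:
  fixes s :: "bit \<Rightarrow> 'b::ab_group_add \<Rightarrow> 'b"
  assumes "vector_space s" "module.subspace s U" "card U = 2 ^ k"
  shows "vector_space.dim s U = k"
proof -
  have "finite U"
    using assms(3) by (metis card.infinite power_not_zero zero_neq_numeral)
  from card_eq_two_power_dim[OF assms(1,2) this] assms(3) show ?thesis
    by simp
qed

text \<open>A bijection of bases extends linearly; with only the scalars 0 and 1, additivity is all
  that linearity says.\<close>

lemma exists_additive_bij_betw:
  fixes s1 :: "bit \<Rightarrow> 'a::ab_group_add \<Rightarrow> 'a" and s2 :: "bit \<Rightarrow> 'b::ab_group_add \<Rightarrow> 'b"
  assumes "vector_space s1" "vector_space s2" "module.subspace s1 V1" "module.subspace s2 V2"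
    and "finite V1" "finite V2" "vector_space.dim s1 V1 = vector_space.dim s2 V2"
  shows "\<exists>f. bij_betw f V1 V2 \<and> f 0 = 0 \<and> (\<forall>x y. f (x + y) = f x + f y)"
proof -
  interpret vector_space_pair s1 s2
    using assms(1,2) by (simp add: vector_space_pair_def)
  obtain B1 where B1: "B1 \<subseteq> V1" "vs1.independent B1" "V1 \<subseteq> vs1.span B1" "card B1 = vs1.dim V1"
    using vs1.basis_exists by blast
  obtain B2 where B2: "B2 \<subseteq> V2" "vs2.independent B2" "V2 \<subseteq> vs2.span B2" "card B2 = vs2.dim V2"
    using vs2.basis_exists by blast
  have fin: "finite B1" "finite B2"
    using B1(1) B2(1) assms(5,6) finite_subset by auto
  have span: "vs1.span B1 = V1" "vs2.span B2 = V2"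
    using B1 B2 vs1.span_minimal[OF B1(1) assms(3)] vs2.span_minimal[OF B2(1) assms(4)] by auto
  obtain h where h: "bij_betw h B1 B2"
    using finite_same_card_bij[OF fin] B1(4) B2(4) assms(7) by auto
  obtain f where f: "Vector_Spaces.linear s1 s2 f" "\<And>x. x \<in> B1 \<Longrightarrow> f x = h x"
    using linear_independent_extend[OF B1(2), of h] by blast
  have "f ` B1 = B2" "inj_on f B1"
    using h f(2) by (auto simp: bij_betw_def inj_on_def)
  hence "bij_betw f V1 V2"
    using linear_span_image[OF f(1), of B1] linear_inj_on_span_independent_image[OF f(1), of B1]
      B2(2) span unfolding bij_betw_def by simp
  thus ?thesis
    using linear_0[OF f(1)] linear_add[OF f(1)] by blast
qed

text \<open>An additive bijection preserves the sizes of members and of their intersections, hence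
  dimensions and distances. This carries codes from \<open>W \<times> GF2 n\<close> to the
  coordinate space in which \<open>A2\<close> is defined.\<close>

lemma is_subspace_code_image:
  fixes s1 :: "bit \<Rightarrow> 'a::ab_group_add \<Rightarrow> 'a" and s2 :: "bit \<Rightarrow> 'b::ab_group_add \<Rightarrow> 'b"
  assumes vs: "vector_space s1" "vector_space s2" and code: "is_subspace_code s1 V1 v M d k C"
    and V2: "module.subspace s2 V2" "finite V2" "vector_space.dim s2 V2 = v"
  shows "\<exists>D. is_subspace_code s2 V2 v M d k D"
proof -
  have V1: "module.subspace s1 V1" "finite V1" "vector_space.dim s1 V1 = v"
    and C: "\<And>A. A \<in> C \<Longrightarrow> module.subspace s1 A" "\<And>A. A \<in> C \<Longrightarrow> A \<subseteq> V1"
      "\<And>A. A \<in> C \<Longrightarrow> vector_space.dim s1 A = k" "card C = M"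
      "\<And>A B. A \<in> C \<Longrightarrow> B \<in> C \<Longrightarrow> A \<noteq> B \<Longrightarrow> int d \<le> subspace_dist s1 A B"
      "\<exists>A\<in>C. \<exists>B\<in>C. A \<noteq> B \<and> subspace_dist s1 A B = int d"
    using code unfolding is_subspace_code_def by auto
  obtain f where f: "bij_betw f V1 V2" "f 0 = 0" "\<And>x y. f (x + y) = f x + f y"
    using exists_additive_bij_betw[OF vs V1(1) V2(1) V1(2) V2(2)] V1(3) V2(3) by auto
  have sub: "module.subspace s2 (f ` A)" if "module.subspace s1 A" for A
  proof -
    have "0 \<in> f ` A"
      using that f(2) unfolding bit_subspace_iff[OF vs(1)] by (metis imageI)
    moreover have "f x + f y \<in> f ` A" if "x \<in> A" "y \<in> A" for x y
      using that \<open>module.subspace s1 A\<close> unfolding bit_subspace_iff[OF vs(1)] f(3)[symmetric] by blast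
    ultimately show ?thesis
      unfolding bit_subspace_iff[OF vs(2)] by blast
  qed
  have dim: "vector_space.dim s2 (f ` A) = vector_space.dim s1 A"
    if "module.subspace s1 A" "A \<subseteq> V1" for A
  proof (rule dim_eqI_card[OF vs(2) sub[OF that(1)]])
    have "card (f ` A) = card A"
      using f(1) that(2) by (intro card_image) (auto simp: bij_betw_def inj_on_def)
    thus "card (f ` A) = 2 ^ vector_space.dim s1 A"
      using card_eq_two_power_dim[OF vs(1) that(1)] that(2) V1(2) finite_subset by metis
  qed
  have dist: "subspace_dist s2 (f ` A) (f ` B) = subspace_dist s1 A B" if "A \<in> C" "B \<in> C" for A B
  proof -
    have "f ` (A \<inter> B) = f ` A \<inter> f ` B"
      using f(1) C(2)[OF that(1)] C(2)[OF that(2)]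
      by (intro inj_on_image_Int[of f V1]) (auto simp: bij_betw_def)
    moreover have "module.subspace s1 (A \<inter> B)"
      using C(1)[OF that(1)] C(1)[OF that(2)] by (auto simp: bit_subspace_iff[OF vs(1)])
    moreover have "A \<inter> B \<subseteq> V1"
      using C(2)[OF that(1)] by blast
    ultimately show ?thesis
      using that dim C(1,2) unfolding subspace_dist_def by metis
  qed
  have inj: "inj_on ((`) f) C"
    using f(1) C(2) inj_on_image_eq_iff[of f V1] unfolding bij_betw_def by (intro inj_onI) auto
  have "is_subspace_code s2 V2 v M d k ((`) f ` C)"
    unfolding is_subspace_code_def
  proof (intro conjI ballI impI)
    show "module.subspace s2 V2" "finite V2" "vector_space.dim s2 V2 = v"
      by (fact V2)+
    show "card ((`) f ` C) = M"
      using inj C(4) by (simp add: card_image)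
    show "\<exists>A\<in>(`) f ` C. \<exists>B\<in>(`) f ` C. A \<noteq> B \<and> subspace_dist s2 A B = int d"
    proof -
      obtain A B where "A \<in> C" "B \<in> C" "A \<noteq> B" "subspace_dist s1 A B = int d"
        using C(6) by blast
      thus ?thesis
        using dist inj_onD[OF inj, of A B] by (intro bexI[of _ "f ` A"] bexI[of _ "f ` B"]) auto
    qed
  next
    fix A assume "A \<in> (`) f ` C"
    then obtain A' where A': "A' \<in> C" "A = f ` A'" by blast
    show "module.subspace s2 A" "A \<subseteq> V2" "vector_space.dim s2 A = k"
      using sub[OF C(1)] dim[OF C(1,2)] C(2)[OF A'(1)] C(3) A' f(1)
      by (auto simp: bij_betw_def)
    fix B assume "B \<in> (`) f ` C" "A \<noteq> B"
    then obtain B' where "B' \<in> C" "B = f ` B'" "A' \<noteq> B'" using A' by blast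
    thus "int d \<le> subspace_dist s2 A B"
      using A' C(5) dist by simp
  qed
  thus ?thesis by blast
qed

section \<open>The coordinate space and lower bounds for \<open>A2\<close>\<close>

lemma card_coord_space: "card (coord_space v) = 2 ^ v"
proof -
  have "bij_betw (\<lambda>S i. if i \<in> S then 1 else 0) (Pow {..<v}) (coord_space v)"
    by (rule bij_betwI[where g = "\<lambda>f. {i. f i = 1}"])
       (auto simp: coord_space_def fun_eq_iff not_le[symmetric])
  thus ?thesis
    by (simp add: bij_betw_same_card[symmetric] card_Pow)
qed

lemma subspace_coord_space: "module.subspace coord_scale (coord_space v)"
  unfolding bit_subspace_iff[OF vector_space_coord_scale] by (auto simp: coord_space_def)

text \<open>\<open>Max\<close> is informative only on a finite set: every admissible size is the
  cardinality of a set of subsets of the finite space \<open>coord_space v\<close>.\<close>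

lemma A2_ge:
  fixes s :: "bit \<Rightarrow> 'a::ab_group_add \<Rightarrow> 'a"
  assumes "vector_space s" "is_subspace_code s V v M d k C"
  shows "M \<le> A2 v d k"
proof -
  have fin: "finite (coord_space v)"
    using card_coord_space[of v] by (metis card.infinite power_not_zero zero_neq_numeral)
  obtain D where D: "is_subspace_code coord_scale (coord_space v) v M d k D"
    using is_subspace_code_image[OF assms(1) vector_space_coord_scale assms(2)
        subspace_coord_space fin
        dim_eqI_card[OF vector_space_coord_scale subspace_coord_space card_coord_space]]
    by blast
  have "{M. \<exists>C. is_subspace_code coord_scale (coord_space v) v M d k C}
      \<subseteq> card ` Pow (Pow (coord_space v))"
    unfolding is_subspace_code_def by blast
  hence "finite {M. \<exists>C. is_subspace_code coord_scale (coord_space v) v M d k C}"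
    by (rule finite_subset) (use fin in auto)
  thus ?thesis
    unfolding A2_def using D by (intro Max_ge) auto
qed

section \<open>Exchanging planes\<close>

type_synonym ac = "bit alg_closure"

lemma ac_add_self [simp]: "(x :: ac) + x = 0" "x + (x + y) = y"
proof -
  show *: "x + x = 0"
    by (metis mult_2 two_bit_alg_closure mult_zero_left)
  show "x + (x + y) = y"
    by (simp add: add.assoc[symmetric] *)
qed

lemma ac_add_eq_0_iff [simp]: "(x :: ac) + y = 0 \<longleftrightarrow> x = y"
  by (metis ac_add_self add_left_cancel)

lemma ac_minus [simp]: "(x :: ac) - y = x + y"
  by (metis ac_add_self(2) add_diff_cancel_left' add.commute)

lemma ac_add_transpose: "(x :: ac) + y = x' + y' \<Longrightarrow> x' = x + (y + y')"
  by (metis ac_add_self add.assoc add.commute)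

lemma ac_power2_add: "((x :: ac) + y) ^ 2 = x ^ 2 + y ^ 2"
  by (simp add: power2_eq_square algebra_simps)

definition quad :: "ac \<Rightarrow> ac \<Rightarrow> ac \<Rightarrow> ac" where
  "quad a b x = a * x + b * x ^ 2"

text \<open>The Moore determinant of x and y, equal to x y (x + y). The expanded form shows that it
  is biadditive and alternating.\<close>

definition delta :: "ac \<Rightarrow> ac \<Rightarrow> ac" where
  "delta x y = x ^ 2 * y + x * y ^ 2"

definition line :: "ac \<Rightarrow> ac \<Rightarrow> ac set" where
  "line x y = {0, x, y, x + y}"

definition graph_plane :: "ac set \<Rightarrow> ac \<Rightarrow> ac \<Rightarrow> (ac \<times> ac) set" where
  "graph_plane W a b = (\<lambda>x. (x, quad a b x)) ` W"

text \<open>The points with t = 0 form the graph of one map over the line; t = 1 translates it by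
  the vertical point \<open>(0, r * delta z1 z2)\<close>.\<close>

definition point_plane :: "ac \<Rightarrow> ac \<Rightarrow> ac \<Rightarrow> ac \<Rightarrow> ac \<Rightarrow> (ac \<times> ac) set" where
  "point_plane z1 z2 a b r =
     (\<lambda>(x, t). (x, r * (quad a b x + t * delta z1 z2))) ` (line z1 z2 \<times> {0, 1})"

lemma quad_add: "quad a b (x + y) = quad a b x + quad a b y"
  by (simp add: quad_def ac_power2_add algebra_simps)

lemma quad_coeff_add: "quad (a + a') (b + b') x = quad a b x + quad a' b' x"
  by (simp add: quad_def algebra_simps)

lemma quad_coeff_mult: "quad (r * a) (r * b) x = r * quad a b x"
  by (simp add: quad_def algebra_simps)

lemma quad_0 [simp]: "quad a b 0 = 0"
  by (simp add: quad_def)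

lemma quad_eq_0:
  assumes "quad a b x = 0" "quad a b y = 0" "x \<noteq> 0" "y \<noteq> 0" "x \<noteq> y"
  shows "a = 0 \<and> b = 0"
proof -
  have "x * (a + b * x) = 0" "y * (a + b * y) = 0"
    using assms(1,2) by (simp_all add: quad_def power2_eq_square algebra_simps)
  hence "a = b * x" "a = b * y"
    using assms(3,4) by auto
  thus ?thesis
    using assms(5) by auto
qed

lemma quad_interpolation:
  assumes "quad a b x = quad a' b' x" "quad a b y = quad a' b' y" "x \<noteq> 0" "y \<noteq> 0" "x \<noteq> y"
  shows "a = a' \<and> b = b'"
  using quad_eq_0[of "a + a'" "b + b'" x y] assms by (simp add: quad_coeff_add)

lemma delta_add: "delta (x + y) z = delta x z + delta y z"
  by (simp add: delta_def ac_power2_add algebra_simps)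

lemma delta_commute: "delta x y = delta y x"
  by (simp add: delta_def algebra_simps)

lemma delta_add_right: "delta x (y + z) = delta x y + delta x z"
  by (metis delta_add delta_commute)

lemma delta_self [simp]: "delta x x = 0"
  by (simp add: delta_def power2_eq_square algebra_simps)

lemma delta_0 [simp]: "delta 0 x = 0"
  by (simp add: delta_def)

lemma delta_eq_0_iff: "delta x y = 0 \<longleftrightarrow> x = 0 \<or> y = 0 \<or> x = y"
proof -
  have "delta x y = x * y * (x + y)"
    by (simp add: delta_def power2_eq_square algebra_simps)
  thus ?thesis by auto
qed

text \<open>Shifting the coefficients by \<open>(z ^ 2, z)\<close> thus changes values by an
  alternating form. On a line containing z this form takes only the values 0 and
  \<open>delta\<close> of the line, which is the ambiguity of a plane through the point p.\<close>

lemma quad_square: "quad (z ^ 2) z x = delta z x"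
  by (simp add: quad_def delta_def)

lemma line_add: "x \<in> line z1 z2 \<Longrightarrow> y \<in> line z1 z2 \<Longrightarrow> x + y \<in> line z1 z2"
  by (auto simp: line_def algebra_simps)

text \<open>A change of basis over the field with two elements has determinant 1, so the alternating
  form \<open>delta\<close> does not see it.\<close>

lemma line_eqI:
  assumes "x \<in> line z1 z2" "y \<in> line z1 z2" "x \<noteq> 0" "y \<noteq> 0" "x \<noteq> y"
  shows "line z1 z2 = line x y" "delta z1 z2 = delta x y"
proof -
  have "line z1 z2 = line x y \<and> delta z1 z2 = delta x y"
    using assms unfolding line_def
    by (elim insertE emptyE)
       (auto simp: algebra_simps delta_add delta_add_right delta_commute[of z2 z1])
  thus "line z1 z2 = line x y" "delta z1 z2 = delta x y" by auto
qed

text \<open>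
  On \<open>line x1 x2\<close> the map \<open>quad (z\<^sup>2) z = delta z\<close> is any prescribed linear map to
  \<open>{0, delta x1 x2}\<close> for a suitable \<open>z\<close>.
\<close>

lemma point_plane_secant:
  assumes "(x1, y1) \<in> point_plane z1 z2 a b r" "(x2, y2) \<in> point_plane z1 z2 a b r"
    and "x1 \<noteq> 0" "x2 \<noteq> 0" "x1 \<noteq> x2"
  shows "\<exists>z\<in>line z1 z2. y1 = quad (r * (a + z ^ 2)) (r * (b + z)) x1 \<and>
                        y2 = quad (r * (a + z ^ 2)) (r * (b + z)) x2"
proof -
  obtain t1 t2 where t: "t1 \<in> {0, 1}" "t2 \<in> {0, 1}" "x1 \<in> line z1 z2" "x2 \<in> line z1 z2"
    and y: "y1 = r * (quad a b x1 + t1 * delta z1 z2)" "y2 = r * (quad a b x2 + t2 * delta z1 z2)"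
    using assms(1,2) unfolding point_plane_def by auto
  note eq = line_eqI[OF t(3,4) assms(3-5)]
  \<comment> \<open>An alternating form kills equal arguments, so the summand with x2 fixes the
    value at x1 and the one with x1 that at x2.\<close>
  define z where "z = t1 * x2 + t2 * x1"
  have "z \<in> line z1 z2"
    unfolding eq z_def using t(1,2) by (auto simp: line_def algebra_simps)
  moreover have "delta z x1 = t1 * delta z1 z2" "delta z x2 = t2 * delta z1 z2"
    unfolding eq z_def using t(1,2) by (auto simp: delta_add delta_commute[of x2 x1])
  ultimately show ?thesis
    using y by (intro bexI[of _ z]) (simp_all add: quad_coeff_mult quad_coeff_add quad_square)
qed

lemma point_plane_0_iff:
  "(0, y) \<in> point_plane z1 z2 a b r \<longleftrightarrow> y = 0 \<or> y = r * delta z1 z2"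
  by (auto simp: point_plane_def line_def image_iff)

lemma point_plane_add:
  assumes "u \<in> point_plane z1 z2 a b r" "v \<in> point_plane z1 z2 a b r"
  shows "u + v \<in> point_plane z1 z2 a b r"
proof -
  obtain x t where u: "x \<in> line z1 z2" "t \<in> {0, 1}" "u = (x, r * (quad a b x + t * delta z1 z2))"
    using assms(1) unfolding point_plane_def by auto
  obtain y s where v: "y \<in> line z1 z2" "s \<in> {0, 1}" "v = (y, r * (quad a b y + s * delta z1 z2))"
    using assms(2) unfolding point_plane_def by auto
  have "t + s \<in> {0, 1}" "x + y \<in> line z1 z2"
    using u v line_add by auto
  moreover have "u + v = (x + y, r * (quad a b (x + y) + (t + s) * delta z1 z2))"
    by (simp add: u v quad_add algebra_simps)
  ultimately show ?thesis
    unfolding point_plane_def by (intro image_eqI[of _ _ "(x + y, t + s)"]) auto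
qed

lemma card_point_plane:
  assumes "z1 \<noteq> 0" "z2 \<noteq> 0" "z1 \<noteq> z2" "r \<noteq> 0"
  shows "card (point_plane z1 z2 a b r) = 8"
proof -
  have "card (line z1 z2) = 4"
    using assms by (auto simp: line_def card_insert_if)
  moreover have "inj_on (\<lambda>(x, t). (x, r * (quad a b x + t * delta z1 z2))) (line z1 z2 \<times> {0, 1})"
    using assms by (auto simp: inj_on_def delta_eq_0_iff)
  ultimately show ?thesis
    unfolding point_plane_def by (subst card_image) (auto simp: card_cartesian_product)
qed

lemma graph_plane_add:
  assumes "\<And>x y. x \<in> W \<Longrightarrow> y \<in> W \<Longrightarrow> x + y \<in> W" "u \<in> graph_plane W a b" "v \<in> graph_plane W a b"
  shows "u + v \<in> graph_plane W a b"
  using assms by (auto simp: graph_plane_def quad_add image_iff)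

lemma card_graph_plane: "card (graph_plane W a b) = card W"
  unfolding graph_plane_def by (rule card_image) (auto simp: inj_on_def)


text \<open>
  \<open>C\<close> is a complement of \<open>GF2 e\<close> in \<open>GF2 n\<close>, closed under multiplication by \<open>GF2 e\<close>; it spreads an
  exchange inside \<open>GF2 e\<close> over \<open>GF2 n\<close>. The graphs of the multiples of \<open>quad (\<alpha> + c) \<beta>\<close> with
  \<open>(\<alpha>, \<beta>) \<in> Q\<close> are taken out. An entry \<open>(z1, z2, a, b) \<in> I\<close> stands for the planes whose four lines
  missing \<open>0 \<times> GF2 n\<close> are, up to a common factor, the graphs of \<open>quad (a + c + z\<^sup>2) (b + z)\<close> on
  \<open>line z1 z2\<close>, for \<open>z \<in> line z1 z2\<close>: by \<open>I_Q\<close> these lines have become free. The multiple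
  through \<open>(0, 1)\<close> has over \<open>x\<close> the two points given by \<open>quad (a + c) b x / delta z1 z2\<close> modulo
  \<open>{0, 1}\<close>, so \<open>I_inj\<close> says that no line meeting \<open>0 \<times> GF2 n\<close> in a point is covered twice.
\<close>

locale exchange =
  fixes n e :: nat and W C :: "ac set" and Q :: "(ac \<times> ac) set" and I :: "(ac \<times> ac \<times> ac \<times> ac) set"
  assumes e_pos: "e > 0" and n_pos: "n > 0"
    and E_sub: "GF2 e \<subseteq> GF2 n"
    and C_sub: "C \<subseteq> GF2 n" and C_0: "0 \<in> C"
    and C_add: "c \<in> C \<Longrightarrow> c' \<in> C \<Longrightarrow> c + c' \<in> C"
    and C_mult: "k \<in> GF2 e \<Longrightarrow> c \<in> C \<Longrightarrow> k * c \<in> C"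
    and C_Int: "c \<in> C \<Longrightarrow> c \<in> GF2 e \<Longrightarrow> c = 0"
    and W_sub: "W \<subseteq> GF2 e" and W_0: "0 \<in> W"
    and W_add: "w \<in> W \<Longrightarrow> w' \<in> W \<Longrightarrow> w + w' \<in> W" and card_W: "card W = 8"
    and Q_sub: "Q \<subseteq> GF2 e \<times> (GF2 e - {0})"
    and Q_inj: "(\<alpha>, \<beta>) \<in> Q \<Longrightarrow> (\<alpha>', \<beta>') \<in> Q \<Longrightarrow> \<alpha> * \<beta>' = \<alpha>' * \<beta> \<Longrightarrow> \<alpha> = \<alpha>' \<and> \<beta> = \<beta>'"
    and I_sub: "I \<subseteq> W \<times> W \<times> GF2 e \<times> GF2 e"
    and I_delta: "(z1, z2, a, b) \<in> I \<Longrightarrow> delta z1 z2 \<noteq> 0"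
    and I_Q: "(z1, z2, a, b) \<in> I \<Longrightarrow> z \<in> line z1 z2 \<Longrightarrow> (a + z ^ 2, b + z) \<in> Q"
    and I_inj: "(z1, z2, a, b) \<in> I \<Longrightarrow> (y1, y2, a', b') \<in> I \<Longrightarrow>
       x \<in> line z1 z2 \<Longrightarrow> x \<in> line y1 y2 \<Longrightarrow> x \<noteq> 0 \<Longrightarrow>
       quad a b x / delta z1 z2 + quad a' b' x / delta y1 y2 \<in> {0, 1} \<Longrightarrow>
       (z1, z2, a, b) = (y1, y2, a', b')"
    and card_I: "card I \<ge> 2"
begin

section \<open>The planes of an exchange, their number and their common points\<close>

definition removed :: "(ac \<times> ac) set" where
  "removed = (\<lambda>((\<alpha>, \<beta>), c, r). (r * (\<alpha> + c), r * \<beta>)) ` (Q \<times> C \<times> (GF2 n - {0}))"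

text \<open>The disjoint sum lets the size be computed on indices; that \<open>plane\<close> is
  injective follows only from the analysis of intersections.\<close>

definition idx :: "((ac \<times> ac) + (ac \<times> ac \<times> ac \<times> ac) \<times> ac \<times> ac) set" where
  "idx = (GF2 n \<times> GF2 n - removed) <+> (I \<times> C \<times> (GF2 n - {0}))"

fun plane :: "((ac \<times> ac) + (ac \<times> ac \<times> ac \<times> ac) \<times> ac \<times> ac) \<Rightarrow> (ac \<times> ac) set" where
  "plane (Inl (a, b)) = graph_plane W a b"
| "plane (Inr ((z1, z2, a, b), c, r)) = point_plane z1 z2 (a + c) b r"

lemma finite_GF2: "m > 0 \<Longrightarrow> finite (GF2 m)"
  using card_GF2[of m] by (metis card.infinite power_not_zero zero_neq_numeral)

lemma finite_sets: "finite Q" "finite C" "finite I" "finite W"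
  using finite_subset[OF Q_sub] finite_subset[OF C_sub] finite_subset[OF I_sub]
    finite_subset[OF W_sub] finite_GF2[OF e_pos] finite_GF2[OF n_pos] by auto

text \<open>Cross-multiplication eliminates r and r'. What remains equates
  \<open>\<alpha> * \<beta>' + \<alpha>' * \<beta>\<close>, in \<open>GF2 e\<close>, with
  \<open>\<beta> * c' + \<beta>' * c\<close>, in C. As C meets \<open>GF2 e\<close> in 0, both sides
  vanish: the first gives equality in Q, and then the second gives c = c'.\<close>

lemma removed_param_inj:
  assumes "(\<alpha>, \<beta>) \<in> Q" "(\<alpha>', \<beta>') \<in> Q" "c \<in> C" "c' \<in> C" "r \<noteq> 0" "r' \<noteq> 0"
    and "r * (\<alpha> + c) = r' * (\<alpha>' + c')" "r * \<beta> = r' * \<beta>'"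
  shows "\<alpha> = \<alpha>' \<and> \<beta> = \<beta>' \<and> c = c' \<and> r = r'"
proof -
  have E: "\<alpha> \<in> GF2 e" "\<beta> \<in> GF2 e" "\<alpha>' \<in> GF2 e" "\<beta>' \<in> GF2 e" "\<beta> \<noteq> 0" "\<beta>' \<noteq> 0"
    using assms(1,2) Q_sub by auto
  have "r * r' * ((\<alpha> + c) * \<beta>') = r * (\<alpha> + c) * (r' * \<beta>')"
    by simp
  also have "\<dots> = r * r' * ((\<alpha>' + c') * \<beta>)"
    unfolding assms(7) assms(8)[symmetric] by simp
  finally have *: "(\<alpha> + c) * \<beta>' = (\<alpha>' + c') * \<beta>"
    using assms(5,6) by simp
  have "(\<alpha> * \<beta>' + \<alpha>' * \<beta>) + (\<beta> * c' + \<beta>' * c) = (\<alpha> + c) * \<beta>' + (\<alpha>' + c') * \<beta>"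
    by (simp only: algebra_simps)
  also have "\<dots> = 0"
    unfolding * by simp
  finally have eq: "\<alpha> * \<beta>' + \<alpha>' * \<beta> = \<beta> * c' + \<beta>' * c"
    by simp
  moreover have "\<beta> * c' + \<beta>' * c \<in> C"
    using assms(3,4) E by (intro C_add C_mult)
  moreover have "\<alpha> * \<beta>' + \<alpha>' * \<beta> \<in> GF2 e"
    using E by (intro GF2_subfield)
  ultimately have "\<alpha> * \<beta>' + \<alpha>' * \<beta> = 0"
    using C_Int by metis
  hence "\<alpha> = \<alpha>' \<and> \<beta> = \<beta>'"
    using Q_inj[OF assms(1,2)] by simp
  thus ?thesis
    using eq E assms(8) by auto
qed

lemma card_removed: "card removed = card Q * card C * (2 ^ n - 1)"
proof -
  have "inj_on (\<lambda>((\<alpha>, \<beta>), c, r). (r * (\<alpha> + c), r * \<beta>)) (Q \<times> C \<times> (GF2 n - {0}))"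
    (is "inj_on ?f ?A")
  proof (rule inj_onI)
    fix p q assume pq: "p \<in> ?A" "q \<in> ?A" "?f p = ?f q"
    obtain \<alpha> \<beta> c r where p: "p = ((\<alpha>, \<beta>), c, r)" by (metis prod.exhaust)
    obtain \<alpha>' \<beta>' c' r' where q: "q = ((\<alpha>', \<beta>'), c', r')" by (metis prod.exhaust)
    show "p = q"
      using removed_param_inj[of \<alpha> \<beta> \<alpha>' \<beta>' c c' r r'] pq by (simp add: p q)
  qed
  thus ?thesis
    unfolding removed_def using n_pos
    by (simp add: card_image card_cartesian_product card_Diff_singleton GF2_subfield card_GF2)
qed

lemma removed_subset: "removed \<subseteq> GF2 n \<times> GF2 n"
proof -
  have "r * (\<alpha> + c) \<in> GF2 n \<and> r * \<beta> \<in> GF2 n"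
    if "(\<alpha>, \<beta>) \<in> Q" "c \<in> C" "r \<in> GF2 n" for \<alpha> \<beta> c r
    using that Q_sub E_sub C_sub by (blast intro: GF2_subfield)
  thus ?thesis
    unfolding removed_def by auto
qed

lemma card_idx:
  "real (card idx) = 2 ^ (2 * n) + (real (card I) - real (card Q)) * real (card C) * (2 ^ n - 1)"
proof -
  have fin: "finite (GF2 n \<times> GF2 n)"
    using finite_GF2[OF n_pos] by simp
  have "card idx = card (GF2 n \<times> GF2 n - removed) + card (I \<times> C \<times> (GF2 n - {0}))"
    unfolding idx_def using fin finite_sets finite_GF2[OF n_pos] by (intro card_Plus) auto
  also have "card (GF2 n \<times> GF2 n - removed) = card (GF2 n \<times> GF2 n) - card removed"
    using fin removed_subset finite_subset by (intro card_Diff_subset) auto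
  finally have "real (card idx) = real (card (GF2 n \<times> GF2 n)) - real (card removed)
      + real (card (I \<times> C \<times> (GF2 n - {0})))"
    using card_mono[OF fin removed_subset] by simp
  moreover have "(2 :: real) ^ (2 * n) = 2 ^ n * 2 ^ n"
    by (simp add: mult_2 power_add)
  ultimately show ?thesis
    using n_pos unfolding card_removed
    by (simp add: card_cartesian_product card_Diff_singleton GF2_subfield card_GF2 of_nat_diff
        algebra_simps)
qed

lemma I_neq: "(z1, z2, a, b) \<in> I \<Longrightarrow> z1 \<noteq> 0 \<and> z2 \<noteq> 0 \<and> z1 \<noteq> z2"
  using I_delta by (auto simp: delta_eq_0_iff)

lemma line_subset_E:
  assumes "(z1, z2, a, b) \<in> I"
  shows "line z1 z2 \<subseteq> W" "delta z1 z2 \<in> GF2 e"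
proof -
  have z: "z1 \<in> W" "z2 \<in> W"
    using assms I_sub by auto
  thus "line z1 z2 \<subseteq> W"
    using W_0 W_add by (auto simp: line_def)
  show "delta z1 z2 \<in> GF2 e"
    using z W_sub unfolding delta_def power2_eq_square by (intro GF2_subfield) auto
qed

text \<open>Dividing by p eliminates the scaling, as p is \<open>r * delta z1 z2\<close> in one
  plane and \<open>r' * delta y1 y2\<close> in the other. The two expressions for y / p differ by a
  part in \<open>GF2 e\<close> and a part in C, which both vanish. The first is the situation of
  \<open>I_inj\<close>, so the entries agree; then the second gives c = c', and p gives r =
  r'.\<close>

lemma point_planes_eqI:
  assumes i: "(z1, z2, a, b) \<in> I" "c \<in> C" "r \<noteq> 0" and j: "(y1, y2, a', b') \<in> I" "c' \<in> C" "r' \<noteq> 0"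
    and p: "(0, p) \<in> point_plane z1 z2 (a + c) b r" "(0, p) \<in> point_plane y1 y2 (a' + c') b' r'" "p \<noteq> 0"
    and y: "(x, y) \<in> point_plane z1 z2 (a + c) b r" "(x, y) \<in> point_plane y1 y2 (a' + c') b' r'" "x \<noteq> 0"
  shows "((z1, z2, a, b), c, r) = ((y1, y2, a', b'), c', r')"
proof -
  define d where "d = delta z1 z2"
  define d' where "d' = delta y1 y2"
  have d: "d \<noteq> 0" "d' \<noteq> 0" "d \<in> GF2 e" "d' \<in> GF2 e"
    using I_delta i(1) j(1) line_subset_E(2) unfolding d_def d'_def by auto
  have pr: "p = r * d" "p = r' * d'"
    using p by (auto simp: point_plane_0_iff d_def d'_def)
  obtain t where t: "x \<in> line z1 z2" "t \<in> {0, 1}" "y = r * (quad (a + c) b x + t * d)"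
    using y(1) unfolding point_plane_def d_def by auto
  obtain t' where t': "x \<in> line y1 y2" "t' \<in> {0, 1}" "y = r' * (quad (a' + c') b' x + t' * d')"
    using y(2) unfolding point_plane_def d'_def by auto
  have E: "x \<in> GF2 e" "a \<in> GF2 e" "b \<in> GF2 e" "a' \<in> GF2 e" "b' \<in> GF2 e"
    using i(1) j(1) I_sub W_sub line_subset_E(1)[OF i(1)] t(1) by auto
  have tt: "t + t' \<in> {0, 1}"
    using t t' by auto
  have "y / p = quad (a + c) b x / d + t"
    using d i(3) unfolding t(3) pr(1) by (simp add: add_divide_distrib)
  moreover have "y / p = quad (a' + c') b' x / d' + t'"
    using d j(3) unfolding t'(3) pr(2) by (simp add: add_divide_distrib)
  ultimately have *: "quad (a + c) b x / d + t = quad (a' + c') b' x / d' + t'"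
    by simp
  have "(quad a b x / d + quad a' b' x / d' + (t + t')) + (inverse d * x * c + inverse d' * x * c')
      = (quad (a + c) b x / d + t) + (quad (a' + c') b' x / d' + t')"
    by (simp only: quad_def field_class.field_divide_inverse algebra_simps)
  also have "\<dots> = 0"
    unfolding * by simp
  finally have eq: "quad a b x / d + quad a' b' x / d' + (t + t') = inverse d * x * c + inverse d' * x * c'"
    by simp
  have "t + t' \<in> GF2 e"
    using tt GF2_subfield(1,2) by fastforce
  moreover have "quad a b x / d + quad a' b' x / d' \<in> GF2 e"
    unfolding quad_def power2_eq_square field_class.field_divide_inverse
    using E d by (intro GF2_subfield(3,5,6))
  ultimately have "quad a b x / d + quad a' b' x / d' + (t + t') \<in> GF2 e"
    by (rule GF2_subfield(3)[rotated])
  moreover have "inverse d * x * c + inverse d' * x * c' \<in> C"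
    using E d i(2) j(2) by (intro C_add C_mult GF2_subfield)
  ultimately have 0: "quad a b x / d + quad a' b' x / d' + (t + t') = 0"
      "inverse d * x * c + inverse d' * x * c' = 0"
    using C_Int eq by metis+
  hence "quad a b x / d + quad a' b' x / d' \<in> {0, 1}"
    using tt by auto
  hence ij: "(z1, z2, a, b) = (y1, y2, a', b')"
    using I_inj[OF i(1) j(1) t(1) t'(1) y(3)] unfolding d_def d'_def by blast
  hence "d = d'"
    by (simp add: d_def d'_def)
  thus ?thesis
    using ij 0(2) pr d y(3) by simp
qed

lemma mem_removed:
  assumes "(z1, z2, a, b) \<in> I" "c \<in> C" "r \<in> GF2 n - {0}" "z \<in> line z1 z2"
  shows "(r * (a + c + z ^ 2), r * (b + z)) \<in> removed"
  unfolding removed_def using assms I_Q[OF assms(1,4)]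
  by (intro image_eqI[of _ _ "((a + z ^ 2, b + z), c, r)"]) (auto simp: algebra_simps)

lemma plane_add: "i \<in> idx \<Longrightarrow> u \<in> plane i \<Longrightarrow> v \<in> plane i \<Longrightarrow> u + v \<in> plane i"
  by (cases i rule: plane.cases) (auto intro!: graph_plane_add point_plane_add W_add)

text \<open>If the first coordinates of u and v are distinct and nonzero, the common line misses
  \<open>0 \<times> GF2 n\<close> and interpolation compares the maps. Otherwise one of u, v, u + v
  is a nonzero common point of \<open>0 \<times> GF2 n\<close>, and only point planes contain such
  points.\<close>

lemma plane_eqI:
  assumes idx: "i \<in> idx" "j \<in> idx" and u: "u \<in> plane i" "u \<in> plane j" "u \<noteq> 0"
    and v: "v \<in> plane i" "v \<in> plane j" "v \<noteq> 0" and "u \<noteq> v"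
  shows "i = j"
proof -
  have main: "i = j" if i: "i \<in> idx" and j: "j \<in> idx"
    and u: "(x1, y1) \<in> plane i" "(x1, y1) \<in> plane j"
    and v: "(x2, y2) \<in> plane i" "(x2, y2) \<in> plane j"
    and x: "x1 \<noteq> 0" "x2 \<noteq> 0" "x1 \<noteq> x2" for i j x1 y1 x2 y2
  proof -
    have secant: "\<exists>z\<in>line z1 z2. y1 = quad (r * (a + c + z ^ 2)) (r * (b + z)) x1 \<and>
          y2 = quad (r * (a + c + z ^ 2)) (r * (b + z)) x2"
      if "(x1, y1) \<in> plane (Inr ((z1, z2, a, b), c, r))" "(x2, y2) \<in> plane (Inr ((z1, z2, a, b), c, r))"
      for z1 z2 a b c r
      using point_plane_secant[OF _ _ x, of y1 z1 z2 "a + c" b r y2] that by simp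
    \<comment> \<open>Two points of a graph determine its map by interpolation, and lying on a
      secant of a point plane forces this map into \<open>removed\<close>.\<close>
    have mixed: False if h: "Inl (a', b') \<in> idx" "(x1, y1) \<in> plane (Inl (a', b'))" "(x2, y2) \<in> plane (Inl (a', b'))"
      and k: "Inr ((z1, z2, a, b), c, r) \<in> idx" "(x1, y1) \<in> plane (Inr ((z1, z2, a, b), c, r))"
        "(x2, y2) \<in> plane (Inr ((z1, z2, a, b), c, r))" for a' b' z1 z2 a b c r
    proof -
      obtain z where z: "z \<in> line z1 z2" "y1 = quad (r * (a + c + z ^ 2)) (r * (b + z)) x1"
          "y2 = quad (r * (a + c + z ^ 2)) (r * (b + z)) x2"
        using secant[OF k(2,3)] by blast
      have "y1 = quad a' b' x1" "y2 = quad a' b' x2"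
        using h(2,3) by (auto simp: graph_plane_def)
      hence "a' = r * (a + c + z ^ 2) \<and> b' = r * (b + z)"
        using z x by (intro quad_interpolation[of _ _ x1 _ _ x2]) auto
      moreover have "(r * (a + c + z ^ 2), r * (b + z)) \<in> removed"
        using k(1) z(1) by (intro mem_removed) (auto simp: idx_def)
      ultimately show False
        using h(1) by (auto simp: idx_def)
    qed
    show "i = j"
    proof (cases i; cases j)
      fix f g assume fg: "i = Inl f" "j = Inl g"
      obtain a b a' b' where ab: "f = (a, b)" "g = (a', b')" by (cases f; cases g)
      have "a = a' \<and> b = b'"
        using u v x fg unfolding ab
        by (intro quad_interpolation[of _ _ x1 _ _ x2]) (auto simp: graph_plane_def)
      thus "i = j" by (simp add: fg ab)
    next
      fix f g assume fg: "i = Inl f" "j = Inr g"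
      obtain a' b' z1 z2 a b c r where "f = (a', b')" "g = ((z1, z2, a, b), c, r)"
        by (metis prod.exhaust)
      thus "i = j"
        using mixed i j u v fg by blast
    next
      fix f g assume fg: "i = Inr g" "j = Inl f"
      obtain a' b' z1 z2 a b c r where "f = (a', b')" "g = ((z1, z2, a, b), c, r)"
        by (metis prod.exhaust)
      thus "i = j"
        using mixed i j u v fg by blast
    next
      fix f g assume fg: "i = Inr f" "j = Inr g"
      obtain z1 z2 a b c r where f: "f = ((z1, z2, a, b), c, r)" by (metis prod.exhaust)
      obtain y1' y2' a' b' c' r' where g: "g = ((y1', y2', a', b'), c', r')" by (metis prod.exhaust)
      have I: "(z1, z2, a, b) \<in> I" "c \<in> C" "r \<noteq> 0" "(y1', y2', a', b') \<in> I" "c' \<in> C" "r' \<noteq> 0"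
        using i j by (auto simp: fg f g idx_def)
      obtain z where z: "z \<in> line z1 z2" "y1 = quad (r * (a + c + z ^ 2)) (r * (b + z)) x1"
          "y2 = quad (r * (a + c + z ^ 2)) (r * (b + z)) x2"
        using secant u(1) v(1) unfolding fg f by blast
      obtain z' where z': "z' \<in> line y1' y2'" "y1 = quad (r' * (a' + c' + z' ^ 2)) (r' * (b' + z')) x1"
          "y2 = quad (r' * (a' + c' + z' ^ 2)) (r' * (b' + z')) x2"
        using secant u(2) v(2) unfolding fg g by blast
      \<comment> \<open>The common secant belongs to one map. Its parameters as a removed map are
        unique, so only the entries can still differ.\<close>
      have "r * (a + c + z ^ 2) = r' * (a' + c' + z' ^ 2) \<and> r * (b + z) = r' * (b' + z')"
        using z z' x by (intro quad_interpolation[of _ _ x1 _ _ x2]) auto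
      hence eq: "a + z ^ 2 = a' + z' ^ 2 \<and> b + z = b' + z' \<and> c = c' \<and> r = r'"
        using I by (intro removed_param_inj I_Q[OF I(1) z(1)] I_Q[OF I(4) z'(1)])
                   (auto simp: algebra_simps)
      have l: "x1 \<in> line z1 z2" "x2 \<in> line z1 z2" "x1 \<in> line y1' y2'" "x2 \<in> line y1' y2'"
        using u v by (auto simp: fg f g point_plane_def)
      have ll: "line z1 z2 = line x1 x2" "delta z1 z2 = delta x1 x2"
          "line y1' y2' = line x1 x2" "delta y1' y2' = delta x1 x2"
        by (fact line_eqI[OF l(1,2) x] line_eqI[OF l(3,4) x])+
      \<comment> \<open>The entries are one coefficient shift by w apart, so over x1 their values
        differ by \<open>delta w x1\<close>, that is by 0 or by \<open>delta x1 x2\<close>; after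
        division this is 0 or 1, as in \<open>I_inj\<close>.\<close>
      define w where "w = z + z'"
      have w: "w \<in> line x1 x2"
        using z(1) z'(1) ll line_add unfolding w_def by simp
      have "a' = a + w ^ 2" "b' = b + w"
        using eq unfolding w_def ac_power2_add by (auto intro: ac_add_transpose)
      hence "quad a b x1 + quad a' b' x1 = delta w x1"
        by (simp add: quad_coeff_add quad_square)
      moreover have "delta w x1 \<in> {0, delta x1 x2}"
        using w by (auto simp: line_def delta_add delta_commute[of x2 x1])
      moreover have "delta x1 x2 \<noteq> 0"
        using x by (simp add: delta_eq_0_iff)
      ultimately have "quad a b x1 / delta z1 z2 + quad a' b' x1 / delta y1' y2' \<in> {0, 1}"
        unfolding ll add_divide_distrib[symmetric] by auto
      hence "(z1, z2, a, b) = (y1', y2', a', b')"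
        using I_inj[OF I(1,4) l(1,3) x(1)] by blast
      thus "i = j"
        using eq by (simp add: fg f g)
    qed
  qed
  have vertical: "i = j" if i: "i \<in> idx" and j: "j \<in> idx" and p: "(0, p) \<in> plane i" "(0, p) \<in> plane j" "p \<noteq> 0"
    and v: "v \<in> plane i" "v \<in> plane j" "v \<noteq> 0" "v \<noteq> (0, p)" for i j p v
  proof -
    obtain f g where fg: "i = Inr f" "j = Inr g"
      using p by (cases i; cases j) (auto simp: graph_plane_def)
    obtain z1 z2 a b c r where f: "f = ((z1, z2, a, b), c, r)" by (metis prod.exhaust)
    obtain y1' y2' a' b' c' r' where g: "g = ((y1', y2', a', b'), c', r')" by (metis prod.exhaust)
    obtain x y where xy: "v = (x, y)" by (cases v)
    have "x \<noteq> 0"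
      using p v by (auto simp: xy fg f point_plane_0_iff zero_prod_def)
    have "((z1, z2, a, b), c, r) = ((y1', y2', a', b'), c', r')"
      using i j p v \<open>x \<noteq> 0\<close> unfolding xy fg f g
      by (intro point_planes_eqI[of _ _ _ _ _ _ _ _ _ _ _ _ p x y]) (auto simp: idx_def)
    thus ?thesis by (simp add: fg f g)
  qed
  obtain x1 y1 x2 y2 where xy: "u = (x1, y1)" "v = (x2, y2)" by (cases u; cases v)
  consider "x1 = 0" | "x2 = 0" | "x1 \<noteq> 0" "x1 = x2" | "x1 \<noteq> 0" "x2 \<noteq> 0" "x1 \<noteq> x2" by blast
  thus ?thesis
  proof cases
    case 1
    thus ?thesis using vertical[OF idx, of y1 v] assms by (auto simp: xy zero_prod_def)
  next
    case 2
    thus ?thesis using vertical[OF idx, of y2 u] assms by (auto simp: xy zero_prod_def)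
  next
    case 3
    have "(0, y1 + y2) = u + v"
      using 3 by (simp add: xy)
    thus ?thesis
      using vertical[OF idx, of "y1 + y2" u] assms plane_add[OF idx(1) u(1) v(1)]
        plane_add[OF idx(2) u(2) v(2)] 3 by (auto simp: xy)
  next
    case 4
    thus ?thesis using main[OF idx] u v by (simp add: xy)
  qed
qed

section \<open>Size, distance and invariance of the code\<close>

lemma idx_cases:
  assumes "i \<in> idx"
  obtains (graph) a b where "i = Inl (a, b)" "a \<in> GF2 n" "b \<in> GF2 n" "(a, b) \<notin> removed"
  | (point) z1 z2 a b c r where "i = Inr ((z1, z2, a, b), c, r)" "(z1, z2, a, b) \<in> I" "c \<in> C"
      "r \<in> GF2 n" "r \<noteq> 0"
  using assms by (cases i rule: plane.cases) (auto simp: idx_def)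

lemma plane_subset:
  assumes "i \<in> idx"
  shows "plane i \<subseteq> W \<times> GF2 n"
  using assms
proof (cases rule: idx_cases)
  case (graph a b)
  thus ?thesis
    using W_sub E_sub
    by (auto simp: graph_plane_def quad_def power2_eq_square intro!: GF2_subfield)
next
  case (point z1 z2 a b c r)
  have W: "line z1 z2 \<subseteq> W" "W \<subseteq> GF2 n" "delta z1 z2 \<in> GF2 n" "a \<in> GF2 n" "b \<in> GF2 n" "c \<in> GF2 n"
    using line_subset_E[OF point(2)] W_sub E_sub C_sub point(2,3) I_sub by auto
  have "r * (quad (a + c) b x + t * delta z1 z2) \<in> GF2 n" if "x \<in> line z1 z2" "t \<in> {0, 1}" for x t
  proof -
    have "x \<in> GF2 n" "t \<in> GF2 n"
      using that W GF2_subfield(1,2) by auto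
    thus ?thesis
      using W point(4) unfolding quad_def power2_eq_square by (intro GF2_subfield(3,5))
  qed
  thus ?thesis
    using W(1) unfolding point(1) by (auto simp: point_plane_def)
qed

lemma card_plane:
  assumes "i \<in> idx"
  shows "card (plane i) = 8"
  using assms
proof (cases rule: idx_cases)
  case (graph a b)
  thus ?thesis using card_W by (simp add: card_graph_plane)
next
  case (point z1 z2 a b c r)
  thus ?thesis using I_neq by (simp add: card_point_plane)
qed

lemma finite_plane: "i \<in> idx \<Longrightarrow> finite (plane i)"
  using card_plane by (metis card.infinite zero_neq_numeral)

lemma zero_in_plane:
  assumes "i \<in> idx"
  shows "0 \<in> plane i"
proof -
  obtain u where "u \<in> plane i"
    using card_plane[OF assms] by (metis card.empty ex_in_conv zero_neq_numeral)
  moreover have "u + u = 0"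
    by (simp add: prod_eq_iff)
  ultimately show ?thesis
    using plane_add[OF assms] by metis
qed

lemma subspace_plane: "i \<in> idx \<Longrightarrow> module.subspace pair_scale (plane i)"
  unfolding bit_subspace_iff[OF vector_space_pair_scale] using zero_in_plane plane_add by blast

lemma plane_eqI_card:
  assumes "i \<in> idx" "j \<in> idx" "card (plane i \<inter> plane j) > 2"
  shows "i = j"
proof -
  let ?A = "plane i \<inter> plane j - {0}"
  have "finite ?A"
    using finite_plane[OF assms(1)] by blast
  moreover have "\<not> card ?A \<le> Suc 0"
    using assms zero_in_plane by (simp add: card_Diff_singleton)
  ultimately obtain u v where "u \<in> ?A" "v \<in> ?A" "u \<noteq> v"
    by (auto simp: card_le_Suc0_iff_eq)
  thus ?thesis
    using plane_eqI[OF assms(1,2), of u v] by blast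
qed

lemma inj_on_plane: "inj_on plane idx"
proof (rule inj_onI)
  fix i j assume "i \<in> idx" "j \<in> idx" "plane i = plane j"
  thus "i = j"
    using plane_eqI_card[of i j] card_plane by simp
qed

lemma dim_plane: "i \<in> idx \<Longrightarrow> vector_space.dim pair_scale (plane i) = 3"
  using dim_eqI_card[OF vector_space_pair_scale subspace_plane, of i 3] card_plane by simp

lemma card_plane_Int:
  assumes "i \<in> idx" "j \<in> idx"
  shows "card (plane i \<inter> plane j) = 2 ^ vector_space.dim pair_scale (plane i \<inter> plane j)"
proof (rule card_eq_two_power_dim[OF vector_space_pair_scale])
  show "module.subspace pair_scale (plane i \<inter> plane j)"
    using subspace_plane[OF assms(1)] subspace_plane[OF assms(2)]
    by (simp add: bit_subspace_iff[OF vector_space_pair_scale])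
  show "finite (plane i \<inter> plane j)"
    using finite_plane[OF assms(1)] by blast
qed

lemma subspace_dist_plane:
  assumes "i \<in> idx" "j \<in> idx"
  shows "subspace_dist pair_scale (plane i) (plane j)
    = 6 - 2 * int (vector_space.dim pair_scale (plane i \<inter> plane j))"
  using assms by (simp add: subspace_dist_def dim_plane)

lemma dim_plane_Int:
  assumes "i \<in> idx" "j \<in> idx" "i \<noteq> j"
  shows "vector_space.dim pair_scale (plane i \<inter> plane j) \<le> 1"
proof -
  have "(2 :: nat) ^ vector_space.dim pair_scale (plane i \<inter> plane j) \<le> 2 ^ 1"
    using plane_eqI_card[OF assms(1,2)] assms(3) card_plane_Int[OF assms(1,2)] by force
  thus ?thesis
    by (subst (asm) power_increasing_iff) auto
qed

text \<open>The minimum distance has to be attained. Scaling two different entries by the inverses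
  of their \<open>delta\<close> makes both planes pass through (0, 1); this is the purpose of
  \<open>card_I\<close>.\<close>

lemma exists_dist_4: "\<exists>i\<in>idx. \<exists>j\<in>idx. i \<noteq> j \<and> subspace_dist pair_scale (plane i) (plane j) = 4"
proof -
  obtain p q where pq: "p \<in> I" "q \<in> I" "p \<noteq> q"
    using card_I by (metis card_le_Suc0_iff_eq finite_sets(3) not_less_eq_eq numeral_2_eq_2)
  obtain z1 z2 a b where p: "p = (z1, z2, a, b)" by (metis prod.exhaust)
  obtain y1 y2 a' b' where q: "q = (y1, y2, a', b')" by (metis prod.exhaust)
  define i where "i = (Inr (p, 0, inverse (delta z1 z2)) :: (ac \<times> ac) + (ac \<times> ac \<times> ac \<times> ac) \<times> ac \<times> ac)"
  define j where "j = (Inr (q, 0, inverse (delta y1 y2)) :: (ac \<times> ac) + (ac \<times> ac \<times> ac \<times> ac) \<times> ac \<times> ac)"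
  have d: "delta z1 z2 \<noteq> 0" "delta y1 y2 \<noteq> 0"
    using I_delta pq by (auto simp: p q)
  have "inverse (delta z1 z2) \<in> GF2 n" "inverse (delta y1 y2) \<in> GF2 n"
    using line_subset_E(2) pq E_sub GF2_subfield(6) unfolding p q by blast+
  hence ij: "i \<in> idx" "j \<in> idx" "i \<noteq> j"
    using pq C_0 d by (auto simp: i_def j_def idx_def)
  have "(0, 1) \<in> plane i" "(0, 1) \<in> plane j"
    using d by (simp_all add: i_def j_def p q point_plane_0_iff)
  hence "{0, (0, 1)} \<subseteq> plane i \<inter> plane j"
    using zero_in_plane[OF ij(1)] zero_in_plane[OF ij(2)] by blast
  moreover have "finite (plane i \<inter> plane j)"
    using finite_plane[OF ij(1)] by blast
  ultimately have "card {0, (0 :: ac, 1 :: ac)} \<le> card (plane i \<inter> plane j)"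
    by (rule card_mono[rotated])
  hence "vector_space.dim pair_scale (plane i \<inter> plane j) \<noteq> 0"
    using card_plane_Int[OF ij(1,2)] by (intro notI) (simp add: zero_prod_def)
  hence "vector_space.dim pair_scale (plane i \<inter> plane j) = 1"
    using dim_plane_Int[OF ij] by simp
  thus ?thesis
    using ij subspace_dist_plane[OF ij(1,2)] by auto
qed

lemma is_subspace_code_planes:
  "is_subspace_code pair_scale (W \<times> GF2 n) (n + 3) (card idx) 4 3 (plane ` idx)"
  unfolding is_subspace_code_def
proof (intro conjI ballI impI)
  show sub: "module.subspace pair_scale (W \<times> GF2 n)"
    unfolding bit_subspace_iff[OF vector_space_pair_scale]
    using W_0 W_add GF2_subfield(1,3) by (auto simp: zero_prod_def)
  show "finite (W \<times> GF2 n)"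
    using finite_sets finite_GF2[OF n_pos] by simp
  show "vector_space.dim pair_scale (W \<times> GF2 n) = n + 3"
    using n_pos by (intro dim_eqI_card[OF vector_space_pair_scale sub])
                   (simp add: card_cartesian_product card_W card_GF2 power_add)
  show "card (plane ` idx) = card idx"
    by (rule card_image[OF inj_on_plane])
  show "\<exists>A\<in>plane ` idx. \<exists>B\<in>plane ` idx. A \<noteq> B \<and> subspace_dist pair_scale A B = int 4"
  proof -
    obtain i j where "i \<in> idx" "j \<in> idx" "i \<noteq> j" "subspace_dist pair_scale (plane i) (plane j) = 4"
      using exists_dist_4 by blast
    thus ?thesis
      using inj_onD[OF inj_on_plane, of i j] by (intro bexI[of _ "plane i"] bexI[of _ "plane j"]) auto
  qed
next
  fix A assume "A \<in> plane ` idx"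
  then obtain i where i: "i \<in> idx" "A = plane i" by blast
  show "module.subspace pair_scale A" "A \<subseteq> W \<times> GF2 n" "vector_space.dim pair_scale A = 3"
    using i subspace_plane plane_subset dim_plane by auto
  fix B assume "B \<in> plane ` idx" "A \<noteq> B"
  then obtain j where "j \<in> idx" "B = plane j" "i \<noteq> j" using i by blast
  thus "int 4 \<le> subspace_dist pair_scale A B"
    using i dim_plane_Int[of i j] by (simp add: subspace_dist_plane)
qed

text \<open>\<open>removed\<close> is closed under multiplication by units because r runs through
  all of them, and on point planes a unit s only sends r to \<open>s * r\<close>.\<close>

lemma invariant_planes: "invariant_under (Sigma_grp n) (plane ` idx)"
  unfolding invariant_under_def
proof (intro ballI)
  fix A g assume "A \<in> plane ` idx" and g: "g \<in> Sigma_grp n"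
  then obtain i where i: "i \<in> idx" "A = plane i" by blast
  obtain s where s: "s \<in> GF2 n" "s \<noteq> 0" "g = (\<lambda>(x, y). (x, s * y))"
    using g unfolding Sigma_grp_def by blast
  from i(1) show "g ` A \<in> plane ` idx"
  proof (cases rule: idx_cases)
    case (graph a b)
    have "(s * a, s * b) \<notin> removed"
    proof
      assume "(s * a, s * b) \<in> removed"
      then obtain \<alpha> \<beta> c r where *: "(\<alpha>, \<beta>) \<in> Q" "c \<in> C" "r \<in> GF2 n" "r \<noteq> 0"
        "s * a = r * (\<alpha> + c)" "s * b = r * \<beta>"
        unfolding removed_def by auto
      hence "a = inverse s * r * (\<alpha> + c)" "b = inverse s * r * \<beta>"
        using s(2) by (simp_all add: field_class.field_divide_inverse[symmetric] nonzero_eq_divide_eq mult.commute)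
      moreover have "inverse s * r \<in> GF2 n - {0}"
        using * s by (simp add: GF2_subfield)
      ultimately have "(a, b) \<in> removed"
        unfolding removed_def using *(1,2)
        by (intro image_eqI[of _ _ "((\<alpha>, \<beta>), c, inverse s * r)"]) auto
      thus False using graph by blast
    qed
    hence "Inl (s * a, s * b) \<in> idx"
      using graph s by (auto simp: idx_def GF2_subfield)
    moreover have "g ` A = plane (Inl (s * a, s * b))"
      unfolding i(2) graph s(3) by (simp add: graph_plane_def image_image quad_coeff_mult)
    ultimately show ?thesis by blast
  next
    case (point z1 z2 a b c r)
    have "Inr ((z1, z2, a, b), c, s * r) \<in> idx"
      using point s by (auto simp: idx_def GF2_subfield)
    moreover have "g ` A = plane (Inr ((z1, z2, a, b), c, s * r))"
      unfolding i(2) point s(3)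
      by (simp add: point_plane_def image_image case_prod_unfold mult.assoc)
    ultimately show ?thesis by blast
  qed
qed

end

section \<open>Exchanges from computations in a small field\<close>

lemma GF2_mono:
  assumes "m dvd n"
  shows "GF2 m \<subseteq> GF2 n"
proof -
  obtain k where k: "n = m * k" using assms by blast
  have "x ^ (2 ^ (m * k)) = x" if "x ^ (2 ^ m) = x" for x :: ac
  proof (induction k)
    case (Suc k)
    have "x ^ (2 ^ (m * Suc k)) = (x ^ (2 ^ (m * k))) ^ (2 ^ m)"
      by (simp add: power_add mult.commute flip: power_mult)
    thus ?case using Suc that by simp
  qed simp
  thus ?thesis by (auto simp: GF2_def k)
qed

text \<open>Among the \<open>GF2 e\<close>-subspaces of \<open>GF2 n\<close> that meet
  \<open>GF2 e\<close> in 0, a maximal one C is a complement: an element u outside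
  \<open>GF2 e\<close> + C could be adjoined.\<close>

lemma exists_GF2_complement:
  assumes "e > 0" "n > 0" "GF2 e \<subseteq> GF2 n"
  obtains C where "C \<subseteq> GF2 n" "0 \<in> C" "\<And>c c'. c \<in> C \<Longrightarrow> c' \<in> C \<Longrightarrow> c + c' \<in> C"
    "\<And>k c. k \<in> GF2 e \<Longrightarrow> c \<in> C \<Longrightarrow> k * c \<in> C" "\<And>c. c \<in> C \<Longrightarrow> c \<in> GF2 e \<Longrightarrow> c = 0"
    "card C * 2 ^ e = 2 ^ n"
proof -
  define good where "good C \<longleftrightarrow> C \<subseteq> GF2 n \<and> 0 \<in> C \<and> (\<forall>c\<in>C. \<forall>c'\<in>C. c + c' \<in> C) \<and>
      (\<forall>k\<in>GF2 e. \<forall>c\<in>C. k * c \<in> C) \<and> (\<forall>c\<in>C. c \<in> GF2 e \<longrightarrow> c = 0)" for C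
  have fin: "finite (GF2 n)" "finite (GF2 e)"
    using card_GF2 assms(1,2) by (metis card.infinite power_not_zero zero_neq_numeral)+
  have "finite {C. good C}"
    by (rule finite_subset[of _ "Pow (GF2 n)"]) (use fin in \<open>auto simp: good_def\<close>)
  moreover have "good {0}"
    by (auto simp: good_def GF2_subfield)
  ultimately obtain C where C: "good C" and max: "\<And>D. good D \<Longrightarrow> C \<subseteq> D \<Longrightarrow> C = D"
    using finite_has_maximal[of "{C. good C}"] by blast
  have C': "C \<subseteq> GF2 n" "0 \<in> C" "\<And>c c'. c \<in> C \<Longrightarrow> c' \<in> C \<Longrightarrow> c + c' \<in> C"
    "\<And>k c. k \<in> GF2 e \<Longrightarrow> c \<in> C \<Longrightarrow> k * c \<in> C" "\<And>c. c \<in> C \<Longrightarrow> c \<in> GF2 e \<Longrightarrow> c = 0"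
    using C unfolding good_def by blast+
  have surj: "\<exists>k\<in>GF2 e. \<exists>c\<in>C. u = k + c" if u: "u \<in> GF2 n" for u
  proof (rule ccontr)
    assume no: "\<not> (\<exists>k\<in>GF2 e. \<exists>c\<in>C. u = k + c)"
    define D where "D = (\<lambda>(c, k). c + k * u) ` (C \<times> GF2 e)"
    have DI: "c + k * u \<in> D" if "c \<in> C" "k \<in> GF2 e" for c k
      using that unfolding D_def by force
    have DE: "\<exists>c\<in>C. \<exists>k\<in>GF2 e. d = c + k * u" if "d \<in> D" for d
      using that unfolding D_def by force
    have "good D"
      unfolding good_def
    proof (intro conjI ballI impI subsetI)
      show "0 \<in> D"
        using DI[of 0 0] C'(2) GF2_subfield(1) by simp
    next
      fix d assume "d \<in> D"
      then obtain c k where d: "c \<in> C" "k \<in> GF2 e" "d = c + k * u" using DE by blast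
      show "d \<in> GF2 n"
        using d C'(1) assms(3) u GF2_subfield(3,5) by blast
      show "d + d' \<in> D" if "d' \<in> D" for d'
      proof -
        obtain c' k' where d': "c' \<in> C" "k' \<in> GF2 e" "d' = c' + k' * u" using DE \<open>d' \<in> D\<close> by blast
        have *: "d + d' = (c + c') + (k + k') * u"
          by (simp add: d d' algebra_simps)
        show ?thesis
          unfolding * using d d' by (intro DI C'(3) GF2_subfield(3))
      qed
      show "l * d \<in> D" if "l \<in> GF2 e" for l
      proof -
        have *: "l * d = l * c + (l * k) * u"
          by (simp add: d algebra_simps)
        show ?thesis
          unfolding * using d that by (intro DI C'(4) GF2_subfield(5))
      qed
      assume dE: "d \<in> GF2 e"
      show "d = 0"
      proof (cases "k = 0")
        case True
        thus ?thesis using d dE C'(5) by simp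
      next
        case False
        \<comment> \<open>For nonzero k the relation solves to u = d / k + c / k, a member of
          \<open>GF2 e\<close> + C, against the choice of u.\<close>
        have "d + c = k * u"
          by (simp add: d(3) add.commute)
        hence "inverse k * d + inverse k * c = inverse k * (k * u)"
          by (metis distrib_left)
        also have "\<dots> = u"
          using False by simp
        finally show ?thesis
          using no d dE C'(4) GF2_subfield(5,6) by metis
      qed
    qed
    moreover have "C \<subseteq> D"
      using DI[of _ 0] GF2_subfield(1) by auto
    ultimately have "C = D" by (rule max)
    moreover have "u \<in> D"
      using DI[of 0 1] C'(2) GF2_subfield(2) by simp
    ultimately show False
      using no GF2_subfield(1)[of e] by force
  qed
  have "bij_betw (\<lambda>(k, c). k + c) (GF2 e \<times> C) (GF2 n)"
    unfolding bij_betw_def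
  proof
    show "inj_on (\<lambda>(k, c). k + c) (GF2 e \<times> C)"
    proof (rule inj_onI)
      fix p q assume pq: "p \<in> GF2 e \<times> C" "q \<in> GF2 e \<times> C" "(\<lambda>(k, c). k + c) p = (\<lambda>(k, c). k + c) q"
      obtain k c k' c' where kc: "p = (k, c)" "q = (k', c')" by (cases p; cases q)
      have "k' = k + (c + c')"
        using pq unfolding kc by (auto intro: ac_add_transpose)
      hence "k + k' = c + c'" by simp
      moreover have "k + k' \<in> GF2 e" "c + c' \<in> C"
        using pq C'(3) GF2_subfield(3) by (auto simp: kc)
      ultimately have "k + k' = 0" "c + c' = 0"
        using C'(5) by metis+
      thus "p = q" by (simp add: kc)
    qed
    show "(\<lambda>(k, c). k + c) ` (GF2 e \<times> C) = GF2 n"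
    proof
      show "(\<lambda>(k, c). k + c) ` (GF2 e \<times> C) \<subseteq> GF2 n"
        using C'(1) assms(3) by (auto intro!: GF2_subfield(3))
      show "GF2 n \<subseteq> (\<lambda>(k, c). k + c) ` (GF2 e \<times> C)"
      proof
        fix u assume "u \<in> GF2 n"
        then obtain k c where "k \<in> GF2 e" "c \<in> C" "u = k + c" using surj by blast
        thus "u \<in> (\<lambda>(k, c). k + c) ` (GF2 e \<times> C)"
          by (intro image_eqI[of _ _ "(k, c)"]) auto
      qed
    qed
  qed
  hence "card (GF2 e \<times> C) = card (GF2 n)"
    by (rule bij_betw_same_card)
  hence "card C * 2 ^ e = 2 ^ n"
    using assms(1,2) by (simp add: card_cartesian_product card_GF2 mult.commute)
  with C' that show ?thesis by blast
qed

text \<open>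
  A Boolean list stands for its polynomial, least significant coefficient first. A modulus \<open>m\<close> of
  length \<open>d\<close> stands for \<open>X\<^sup>d + m\<close>; residues have length \<open>d\<close>. The expensive functions are
  defined by first-order recursion, without \<open>let\<close> and \<open>map\<close>: \<open>code_simp\<close> also rewrites under
  abstractions, where the arithmetic on open terms explodes.
\<close>

fun ladd :: "bool list \<Rightarrow> bool list \<Rightarrow> bool list" where
  "ladd [] q = q"
| "ladd p [] = p"
| "ladd (a # p) (b # q) = (a \<noteq> b) # ladd p q"

text \<open>Multiplication by X: a top coefficient that overflows is replaced by m, since X^d = m in
  characteristic two.\<close>

definition lshift :: "bool list \<Rightarrow> bool list \<Rightarrow> bool list" where
  "lshift m p = (if last p then ladd m (False # butlast p) else False # butlast p)"

definition lzero :: "bool list \<Rightarrow> bool list" where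
  "lzero m = map (\<lambda>_. False) m"

definition lone :: "bool list \<Rightarrow> bool list" where
  "lone m = True # lzero (tl m)"

fun ladd_if :: "bool \<Rightarrow> bool list \<Rightarrow> bool list \<Rightarrow> bool list" where
  "ladd_if True p q = ladd p q"
| "ladd_if False p q = q"

fun lmul :: "bool list \<Rightarrow> bool list \<Rightarrow> bool list \<Rightarrow> bool list" where
  "lmul m [] q = lzero m"
| "lmul m (a # p) q = ladd_if a q (lshift m (lmul m p q))"

definition lsquare :: "bool list \<Rightarrow> bool list \<Rightarrow> bool list" where
  "lsquare m p = lmul m p p"

fun lfrob :: "bool list \<Rightarrow> nat \<Rightarrow> bool list \<Rightarrow> bool list" where
  "lfrob m 0 p = p"
| "lfrob m (Suc k) p = lfrob m k (lsquare m p)"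

text \<open>\<open>lpow_ones m k p\<close> is the power of \<open>p\<close> to the exponent \<open>2\<^sup>k - 1\<close>; the inverse is the power to
  \<open>2\<^sup>d - 2\<close>.\<close>

fun lpow_ones :: "bool list \<Rightarrow> nat \<Rightarrow> bool list \<Rightarrow> bool list" where
  "lpow_ones m 0 p = lone m"
| "lpow_ones m (Suc k) p = lmul m p (lsquare m (lpow_ones m k p))"

definition linv :: "bool list \<Rightarrow> bool list \<Rightarrow> bool list" where
  "linv m p = lsquare m (lpow_ones m (length m - 1) p)"

fun linvs_ok :: "bool list \<Rightarrow> bool list list \<Rightarrow> bool" where
  "linvs_ok m [] = True"
| "linvs_ok m (p # ps) = ((if p = lzero m then True else lmul m p (linv m p) = lone m) \<and> linvs_ok m ps)"

text \<open>In place of irreducibility, its consequences are tested directly: X^(2^d) = X, which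
  puts the root in \<open>GF2 d\<close>, and an inverse for every nonzero residue, which makes
  evaluation injective.\<close>

definition is_field_modulus :: "bool list \<Rightarrow> bool" where
  "is_field_modulus m \<longleftrightarrow> length m > 1 \<and>
     lfrob m (length m) (lshift m (lone m)) = lshift m (lone m) \<and>
     linvs_ok m (List.n_lists (length m) [False, True])"

definition lquad :: "bool list \<Rightarrow> bool list \<Rightarrow> bool list \<Rightarrow> bool list \<Rightarrow> bool list" where
  "lquad m a b x = ladd (lmul m a x) (lmul m b (lsquare m x))"

definition ldelta :: "bool list \<Rightarrow> bool list \<Rightarrow> bool list \<Rightarrow> bool list" where
  "ldelta m x y = ladd (lmul m (lsquare m x) y) (lmul m x (lsquare m y))"

definition lline :: "bool list \<Rightarrow> bool list \<Rightarrow> bool list \<Rightarrow> bool list list" where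
  "lline m x y = [lzero m, x, y, ladd x y]"

primrec leval :: "ac \<Rightarrow> bool list \<Rightarrow> ac" where
  "leval g [] = 0"
| "leval g (a # p) = of_bool a + g * leval g p"

lemma length_ladd [simp]: "length p = length q \<Longrightarrow> length (ladd p q) = length q"
  by (induction p q rule: ladd.induct) auto

lemma length_lzero [simp]: "length (lzero m) = length m"
  by (simp add: lzero_def)

lemma leval_ladd [simp]: "leval g (ladd p q) = leval g p + leval g q"
  by (induction p q rule: ladd.induct) (auto simp: algebra_simps)

lemma leval_lzero [simp]: "leval g (lzero m) = 0"
  by (induction m) (auto simp: lzero_def)

lemma leval_lone [simp]: "leval g (lone m) = 1"
  by (simp add: lone_def)

lemma leval_append: "leval g (p @ q) = leval g p + g ^ length p * leval g q"
  by (induction p) (auto simp: algebra_simps)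

lemma ladd_eq_lzero:
  assumes "length p = length m" "length q = length m" "ladd p q = lzero m"
  shows "p = q"
proof -
  have "length p = length q" "ladd p q = replicate (length p) False"
    using assms by (simp_all add: lzero_def map_replicate_const)
  thus ?thesis
  proof (induction p q rule: list_induct2)
    case (Cons a p b q)
    have "p = q"
      by (rule Cons.IH) (use Cons.prems in simp)
    thus ?case using Cons.prems by simp
  qed simp
qed

lemma exists_modulus_root:
  assumes "m \<noteq> []"
  shows "\<exists>g :: ac. g ^ length m = leval g m"
proof -
  define P :: "bool list \<Rightarrow> ac poly" where "P = (\<lambda>p. Poly (map of_bool p))"
  have P: "poly (P p) g = leval g p" for p g
    by (induction p) (auto simp: P_def)
  have "degree (P m) \<le> length m - 1"
    by (rule degree_le) (auto simp: P_def coeff_Poly_eq nth_default_def)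
  hence "degree (P m) < length m"
    using assms by (cases m) auto
  hence "degree (P m + monom 1 (length m)) = length m"
    by (subst degree_add_eq_right) (auto simp: degree_monom_eq)
  then obtain g where "poly (P m + monom 1 (length m)) g = 0"
    using alg_closed_imp_poly_has_root[of "P m + monom 1 (length m)"] assms by auto
  thus ?thesis
    by (intro exI[of _ g]) (simp add: P poly_monom)
qed

section \<open>Bit lists as elements of a subfield of the algebraic closure\<close>

locale list_field =
  fixes m :: "bool list" and g :: ac
  assumes modulus: "is_field_modulus m" and root: "g ^ length m = leval g m"
begin

lemma length_m: "length m > 1"
  using modulus by (simp add: is_field_modulus_def)

lemma length_lone [simp]: "length (lone m) = length m"
  using length_m by (simp add: lone_def)

lemma length_lshift [simp]: "length p = length m \<Longrightarrow> length (lshift m p) = length m"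
  using length_m by (simp add: lshift_def)

lemma leval_lshift [simp]:
  assumes "length p = length m"
  shows "leval g (lshift m p) = g * leval g p"
proof -
  obtain d where d: "length m = Suc d"
    using length_m by (cases "length m") auto
  have "p \<noteq> []" using assms length_m by auto
  hence "leval g p = leval g (butlast p @ [last p])" by simp
  also have "\<dots> = leval g (butlast p) + g ^ d * of_bool (last p)"
    unfolding leval_append using assms d by simp
  finally have "g * leval g p = g * leval g (butlast p) + g ^ length m * of_bool (last p)"
    by (simp add: d algebra_simps)
  thus ?thesis
    by (simp add: lshift_def root add.commute)
qed

lemma length_lmul [simp]: "length q = length m \<Longrightarrow> length (lmul m p q) = length m"
proof (induction p)
  case (Cons a p)
  thus ?case by (cases a) auto
qed simp

lemma leval_lmul [simp]: "length q = length m \<Longrightarrow> leval g (lmul m p q) = leval g p * leval g q"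
proof (induction p)
  case (Cons a p)
  thus ?case by (cases a) (auto simp: algebra_simps)
qed simp

lemma length_lsquare [simp]: "length p = length m \<Longrightarrow> length (lsquare m p) = length m"
  by (simp add: lsquare_def)

lemma leval_lsquare [simp]: "length p = length m \<Longrightarrow> leval g (lsquare m p) = leval g p ^ 2"
  by (simp add: lsquare_def power2_eq_square)

lemma length_linv [simp]:
  assumes "length p = length m"
  shows "length (linv m p) = length m"
proof -
  have "length (lpow_ones m k p) = length m" for k
    by (induction k) (auto simp: assms)
  thus ?thesis using assms by (simp add: linv_def)
qed

lemma lmul_linv: "length p = length m \<Longrightarrow> p \<noteq> lzero m \<Longrightarrow> lmul m p (linv m p) = lone m"
proof -
  have "linvs_ok m ps \<longleftrightarrow> (\<forall>p\<in>set ps. p = lzero m \<or> lmul m p (linv m p) = lone m)" for ps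
    by (induction ps) auto
  thus "length p = length m \<Longrightarrow> p \<noteq> lzero m \<Longrightarrow> lmul m p (linv m p) = lone m"
    using modulus by (auto simp: is_field_modulus_def set_n_lists)
qed

text \<open>A nonzero residue has an inverse, so its value divides 1. Hence evaluation is injective
  (\<open>leval_inject\<close>), and distinct lists stand for distinct field elements.\<close>

lemma leval_eq_0_iff:
  assumes "length p = length m"
  shows "leval g p = 0 \<longleftrightarrow> p = lzero m"
  using lmul_linv[OF assms] leval_lmul[OF length_linv[OF assms], of p]
  by (cases "p = lzero m") auto

lemma leval_inject: "length p = length m \<Longrightarrow> length q = length m \<Longrightarrow> leval g p = leval g q \<longleftrightarrow> p = q"
  using leval_eq_0_iff[of "ladd p q"] ladd_eq_lzero[of p m q] by auto

lemma leval_linv: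
  assumes "length p = length m" "p \<noteq> lzero m"
  shows "leval g (linv m p) = inverse (leval g p)"
  using lmul_linv[OF assms] leval_lmul[OF length_linv[OF assms(1)], of p] leval_eq_0_iff[OF assms(1)]
    assms(2) by (simp add: inverse_unique)

lemma leval_mem: "leval g p \<in> GF2 (length m)"
proof -
  have *: "leval g (lfrob m k q) = leval g q ^ (2 ^ k)" if "length q = length m" for k q
    using that
  proof (induction k arbitrary: q)
    case (Suc k)
    thus ?case
      by (simp add: power_mult)
  qed simp
  have "leval g (lfrob m (length m) (lshift m (lone m))) = leval g (lshift m (lone m))"
    using modulus by (simp add: is_field_modulus_def)
  hence "g \<in> GF2 (length m)"
    unfolding GF2_def by (simp add: *)
  thus ?thesis
    by (induction p) (auto intro!: GF2_subfield)
qed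

lemma leval_lquad [simp]: "length x = length m \<Longrightarrow>
    leval g (lquad m a b x) = quad (leval g a) (leval g b) (leval g x)"
  by (simp add: lquad_def quad_def)

lemma length_lquad [simp]: "length x = length m \<Longrightarrow> length (lquad m a b x) = length m"
  by (simp add: lquad_def)

lemma leval_ldelta [simp]: "length x = length m \<Longrightarrow> length y = length m \<Longrightarrow>
    leval g (ldelta m x y) = delta (leval g x) (leval g y)"
  by (simp add: ldelta_def delta_def)

lemma length_ldelta [simp]: "length x = length m \<Longrightarrow> length y = length m \<Longrightarrow> length (ldelta m x y) = length m"
  by (simp add: ldelta_def)

lemma leval_lline: "leval g ` set (lline m x y) = line (leval g x) (leval g y)"
  by (simp add: lline_def line_def)

lemma length_lline: "length x = length m \<Longrightarrow> length y = length m \<Longrightarrow> z \<in> set (lline m x y) \<Longrightarrow> length z = length m"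
  by (auto simp: lline_def)

end

section \<open>Certificates for an exchange in the small field\<close>

definition W_ok :: "bool list \<Rightarrow> bool list list \<Rightarrow> bool" where
  "W_ok m Wl \<longleftrightarrow> list_all (\<lambda>w. length w = length m) Wl \<and> lzero m \<in> set Wl \<and>
     length Wl = 8 \<and> distinct Wl \<and> list_all (\<lambda>w. list_all (\<lambda>w'. ladd w w' \<in> set Wl) Wl) Wl"

fun lratios_at :: "bool list \<Rightarrow> bool list \<Rightarrow> bool list \<Rightarrow> (bool list \<times> bool list) list \<Rightarrow> bool list list" where
  "lratios_at m w w2 [] = []"
| "lratios_at m w w2 ((a, b) # F) = lmul m (ladd a w2) (linv m (ladd b w)) # lratios_at m w w2 F"

fun lratios :: "bool list \<Rightarrow> bool list list \<Rightarrow> (bool list \<times> bool list) list \<Rightarrow> bool list list" where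
  "lratios m [] F = []"
| "lratios m (w # ws) F = lratios_at m w (lsquare m w) F @ lratios m ws F"

text \<open>Up to scaling, a map with nonzero second coefficient is determined by the ratio of its
  coefficients, so distinct ratios give \<open>Q_inj\<close>. With b outside W every b + w is
  nonzero.\<close>

definition F_ok :: "bool list \<Rightarrow> bool list list \<Rightarrow> (bool list \<times> bool list) list \<Rightarrow> bool" where
  "F_ok m Wl Fl \<longleftrightarrow>
     list_all (\<lambda>(a, b). length a = length m \<and> length b = length m \<and> b \<notin> set Wl) Fl \<and>
     distinct (lratios m Wl Fl)"

fun lquads :: "bool list \<Rightarrow> bool list \<Rightarrow> (bool list \<times> bool list) list \<Rightarrow> bool list list" where
  "lquads m x [] = []"
| "lquads m x ((a, b) # F) = lquad m a b x # lquads m x F"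

text \<open>Dropping the constant coefficient by \<open>tl\<close> is reduction modulo \<open>{0, 1}\<close>.\<close>

fun lscaled :: "bool list \<Rightarrow> bool list \<Rightarrow> bool list \<Rightarrow> bool list list \<Rightarrow> bool list list" where
  "lscaled m d u [] = []"
| "lscaled m d u (f # fs) = tl (lmul m (ladd f u) d) # lscaled m d u fs"

fun lshifted :: "bool list \<Rightarrow> bool list \<Rightarrow> bool list \<Rightarrow> bool list list \<Rightarrow> bool list list \<Rightarrow> bool list list" where
  "lshifted m d x fs [] = []"
| "lshifted m d x fs (w # ws) = lscaled m d (ldelta m w x) fs @ lshifted m d x fs ws"

text \<open>The values over x of the planes normalised to pass through (0, 1), as in
  \<open>I_inj\<close>. The shift by w enters as \<open>delta w x\<close>, so \<open>fs\<close>, the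
  values of the unshifted maps at x, serves every line and coset.\<close>

fun lvalues :: "bool list \<Rightarrow> bool list \<Rightarrow> bool list list \<Rightarrow>
    (bool list \<times> bool list \<times> bool list list) list \<Rightarrow> bool list list" where
  "lvalues m x fs [] = []"
| "lvalues m x fs ((z1, z2, ws) # G) =
     (if x \<in> set (lline m z1 z2) then lshifted m (linv m (ldelta m z1 z2)) x fs ws else [])
     @ lvalues m x fs G"

text \<open>In an entry \<open>(z1, z2, ws)\<close> each w stands for a coset of the line. Two w in
  one coset would give values equal modulo {0, 1} for the same map, which \<open>values_ok\<close>
  excludes.\<close>

definition G_ok :: "bool list \<Rightarrow> bool list list \<Rightarrow> (bool list \<times> bool list \<times> bool list list) list \<Rightarrow> bool" where
  "G_ok m Wl G \<longleftrightarrow> distinct G \<and>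
     list_all (\<lambda>(z1, z2, ws). z1 \<in> set Wl \<and> z2 \<in> set Wl \<and> ldelta m z1 z2 \<noteq> lzero m \<and>
       distinct ws \<and> list_all (\<lambda>w. w \<in> set Wl) ws) G"

fun values_ok :: "bool list \<Rightarrow> bool list list \<Rightarrow> (bool list \<times> bool list) list \<Rightarrow>
    (bool list \<times> bool list \<times> bool list list) list \<Rightarrow> bool" where
  "values_ok m [] F G = True"
| "values_ok m (x # xs) F G \<longleftrightarrow>
     (if x = lzero m then True else distinct (lvalues m x (lquads m x F) G)) \<and> values_ok m xs F G"

fun lbits :: "nat \<Rightarrow> int \<Rightarrow> bool list" where
  "lbits 0 k = []"
| "lbits (Suc d) k = odd k # lbits d (k div 2)"

text \<open>
  The bit patterns below, including the choice of \<open>W8\<close>, were found by a clique search. Over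
  \<open>GF2 4\<close> eight classes of graphs are traded for eleven classes of planes, over \<open>GF2 8\<close> it is
  \<open>9 \<cdot> 8 = 72\<close> for \<open>9 \<cdot> 14 = 126\<close>.
\<close>

definition modulus4 :: "bool list" where
  "modulus4 = lbits 4 3"

definition W4 :: "bool list list" where
  "W4 = map (lbits 4) [0, 1, 2, 3, 4, 5, 6, 7]"

text \<open>The pair is X^3 + X^2 and X^3; the latter lies outside \<open>W4\<close>, the span of 1,
  X, X^2.\<close>

definition F4 :: "(bool list \<times> bool list) list" where
  "F4 = [(lbits 4 12, lbits 4 8)]"

text \<open>All seven lines of \<open>W4\<close> occur, four with both cosets and three with one,
  which makes 11.\<close>

definition G4 :: "(bool list \<times> bool list \<times> bool list list) list" where
  "G4 = map (\<lambda>(j, k, ws). (lbits 4 j, lbits 4 k, map (lbits 4) ws))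
     [(1, 2, [0, 4]), (1, 4, [0, 2]), (1, 6, [0, 2]), (2, 4, [0]), (2, 5, [0, 1]), (3, 4, [0]), (3, 5, [1])]"

text \<open>The reduction polynomial is X^8 + X^4 + X^3 + X^2 + 1, as 29 = 16 + 8 + 4 + 1; for
  \<open>modulus4\<close> it is X^4 + X + 1.\<close>

definition modulus8 :: "bool list" where
  "modulus8 = lbits 8 29"

definition W8 :: "bool list list" where
  "W8 = map (lbits 8) [0, 1, 78, 79, 152, 153, 214, 215]"

definition F8 :: "(bool list \<times> bool list) list" where
  "F8 = map (\<lambda>(j, k). (lbits 8 j, lbits 8 k)) [(138, 24), (45, 58), (105, 48), (32, 46), (96, 38),
     (36, 44), (100, 36), (162, 42), (230, 32)]"

text \<open>All seven lines of \<open>W8\<close> occur with both cosets, so each pair in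
  \<open>F8\<close> yields the full fourteen.\<close>

definition G8 :: "(bool list \<times> bool list \<times> bool list list) list" where
  "G8 = map (\<lambda>(j, k, l). (lbits 8 j, lbits 8 k, [lbits 8 0, lbits 8 l]))
     [(1, 78, 152), (1, 152, 78), (1, 214, 78), (78, 152, 1), (78, 153, 1), (79, 152, 1), (79, 153, 1)]"

lemma ac_add_eq_iff: "(x :: ac) + y = z \<longleftrightarrow> x = z + y"
  by (metis ac_add_self add.assoc add.commute)

lemma ladd_lzero:
  assumes "length p = length q"
  shows "ladd (lzero p) q = q"
  using assms by (induction p q rule: list_induct2) (auto simp: lzero_def)

context list_field
begin

text \<open>For each pair in \<open>Fl\<close> the eight maps given by w in W are removed, so every
  coset of every line becomes available. The checks on lists carry over to the field because
  evaluation is injective.\<close>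

lemma exchange_code:
  assumes W: "W_ok m Wl" and F: "F_ok m Wl Fl" and G: "G_ok m Wl G" and vals: "values_ok m Wl Fl G"
    and n: "length m dvd n" "n > 0"
    and two: "length Fl * (\<Sum>(z1, z2, ws)\<leftarrow>G. length ws) \<ge> 2"
  shows "\<exists>W M C. W \<subseteq> GF2 n \<and> module.subspace ac_scale W \<and> vector_space.dim ac_scale W = 3 \<and>
    is_subspace_code pair_scale (W \<times> GF2 n) (n + 3) M 4 3 C \<and> invariant_under (Sigma_grp n) C \<and>
    real M = 2 ^ (2 * n) + real (length Fl) * (real (\<Sum>(z1, z2, ws)\<leftarrow>G. length ws) - 8) *
      2 ^ (n - length m) * (2 ^ n - 1)"
proof -
  define d where "d = length m"
  have d: "d > 0" "GF2 d \<subseteq> GF2 n"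
    using length_m GF2_mono[OF n(1)] by (auto simp: d_def)
  obtain C where C: "C \<subseteq> GF2 n" "0 \<in> C" "\<And>c c'. c \<in> C \<Longrightarrow> c' \<in> C \<Longrightarrow> c + c' \<in> C"
    "\<And>k c. k \<in> GF2 d \<Longrightarrow> c \<in> C \<Longrightarrow> k * c \<in> C" "\<And>c. c \<in> C \<Longrightarrow> c \<in> GF2 d \<Longrightarrow> c = 0"
    "card C * 2 ^ d = 2 ^ n"
    using exists_GF2_complement[OF d(1) n(2) d(2)] by blast
  define ev where "ev = leval g"
  have evE: "ev p \<in> GF2 d" for p
    using leval_mem by (simp add: ev_def d_def)

  have Wl: "\<And>w. w \<in> set Wl \<Longrightarrow> length w = length m" "lzero m \<in> set Wl" "length Wl = 8" "distinct Wl"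
    "\<And>w w'. w \<in> set Wl \<Longrightarrow> w' \<in> set Wl \<Longrightarrow> ladd w w' \<in> set Wl"
    using W by (auto simp: W_ok_def list_all_iff)
  have Fl: "\<And>a b. (a, b) \<in> set Fl \<Longrightarrow> length a = length m \<and> length b = length m \<and> b \<notin> set Wl"
    "distinct (lratios m Wl Fl)"
    using F by (auto simp: F_ok_def list_all_iff)
  have Gl: "distinct G" "\<And>z1 z2 ws. (z1, z2, ws) \<in> set G \<Longrightarrow> z1 \<in> set Wl \<and> z2 \<in> set Wl \<and>
      ldelta m z1 z2 \<noteq> lzero m \<and> distinct ws \<and> set ws \<subseteq> set Wl"
    using G by (auto simp: G_ok_def list_all_iff)

  define W where "W = ev ` set Wl"
  have W0: "0 \<in> W"
    using Wl(2) unfolding W_def ev_def by (metis imageI leval_lzero)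
  have W_add: "w + w' \<in> W" if "w \<in> W" "w' \<in> W" for w w'
    using that Wl(5) unfolding W_def ev_def by (auto simp flip: leval_ladd)
  have "inj_on ev (set Wl)"
    using Wl(1) leval_inject by (auto simp: inj_on_def ev_def)
  hence card_W: "card W = 8"
    using Wl(3,4) unfolding W_def by (simp add: card_image distinct_card)

  have b_plus_w: "ladd b w \<noteq> lzero m" if "(a, b) \<in> set Fl" "w \<in> set Wl" for a b w
    using ladd_eq_lzero[of b m w] Fl(1)[OF that(1)] Wl(1)[OF that(2)] that(2) by blast

  define qQ where "qQ = (\<lambda>(w, a, b). (ev (ladd a (lsquare m w)), ev (ladd b w)))"
  define Q where "Q = qQ ` (set Wl \<times> set Fl)"
  have ratios: "lratios m Wl Fl = map (\<lambda>(w, a, b). lmul m (ladd a (lsquare m w)) (linv m (ladd b w)))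
      (List.product Wl Fl)"
  proof -
    have at: "lratios_at m w w2 F = map (\<lambda>(a, b). lmul m (ladd a w2) (linv m (ladd b w))) F" for w w2 F
      by (induction F) auto
    have "lratios m Wl' Fl = map (\<lambda>(w, a, b). lmul m (ladd a (lsquare m w)) (linv m (ladd b w)))
      (List.product Wl' Fl)" for Wl'
      by (induction Wl') (auto simp: at case_prod_unfold)
    thus ?thesis .
  qed
  have distinct_prod: "distinct (List.product Wl Fl)"
    using Fl(2) unfolding ratios by (simp add: distinct_map)
  have distinct_Fl: "distinct Fl"
    using distinct_prod Wl(2) by (cases Wl) (auto simp: distinct_map)
  have Q_inj': "(w, a, b) = (w', a', b')"
    if w: "w \<in> set Wl" "w' \<in> set Wl" and ab: "(a, b) \<in> set Fl" "(a', b') \<in> set Fl"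
      and eq: "ev (ladd a (lsquare m w)) * ev (ladd b' w') = ev (ladd a' (lsquare m w')) * ev (ladd b w)"
    for w a b w' a' b'
  proof -
    have len: "length w = length m" "length w' = length m" "length b = length m" "length b' = length m"
      using w ab Wl(1) Fl(1) by auto
    have nz: "ladd b w \<noteq> lzero m" "ladd b' w' \<noteq> lzero m"
      using b_plus_w w ab by blast+
    hence nz': "ev (ladd b w) \<noteq> 0" "ev (ladd b' w') \<noteq> 0"
      using leval_eq_0_iff len by (auto simp: ev_def simp del: leval_ladd)
    have "ev (lmul m (ladd a (lsquare m w)) (linv m (ladd b w)))
        = ev (ladd a (lsquare m w)) * inverse (ev (ladd b w))"
      using len nz by (simp add: ev_def leval_linv del: leval_ladd)
    also have "\<dots> = ev (ladd a' (lsquare m w')) * inverse (ev (ladd b' w'))"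
      using eq nz' by (simp add: field_class.field_divide_inverse[symmetric] frac_eq_eq)
    also have "\<dots> = ev (lmul m (ladd a' (lsquare m w')) (linv m (ladd b' w')))"
      using len nz by (simp add: ev_def leval_linv del: leval_ladd)
    finally have *: "lmul m (ladd a (lsquare m w)) (linv m (ladd b w))
        = lmul m (ladd a' (lsquare m w')) (linv m (ladd b' w'))"
      using leval_inject len by (simp add: ev_def del: leval_ladd leval_lmul)
    have inj: "inj_on (\<lambda>(w, a, b). lmul m (ladd a (lsquare m w)) (linv m (ladd b w))) (set Wl \<times> set Fl)"
      using Fl(2) unfolding ratios by (simp add: distinct_map)
    show ?thesis
      using inj_onD[OF inj, of "(w, a, b)" "(w', a', b')"] w ab * by simp
  qed
  have "inj_on qQ (set Wl \<times> set Fl)"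
    using Q_inj' by (auto simp: inj_on_def qQ_def)
  hence card_Q: "card Q = 8 * length Fl"
    unfolding Q_def using Wl(3,4) distinct_Fl
    by (simp add: card_image card_cartesian_product distinct_card)

  define IX where "IX = (SIGMA (z1, z2, ws):set G. set ws \<times> set Fl)"
  define iI where "iI = (\<lambda>((z1, z2, ws :: bool list list), w, a, b).
      (ev z1, ev z2, ev (ladd a (lsquare m w)), ev (ladd b w)))"
  define val where "val = (\<lambda>x ((z1, z2, ws :: bool list list), w, a, b).
      lmul m (ladd (lquad m a b x) (ldelta m w x)) (linv m (ldelta m z1 z2)))"
  define on where "on = (\<lambda>x ((z1, z2, ws :: bool list list), w :: bool list, a :: bool list, b :: bool list).
      x \<in> set (lline m z1 z2))"
  define I where "I = iI ` IX"
  have vals_inj: "p = q" if x: "x \<in> set Wl" "x \<noteq> lzero m" and pq: "p \<in> IX" "q \<in> IX" "on x p" "on x q"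
      "tl (val x p) = tl (val x q)" for x p q
  proof -
    \<comment> \<open>\<open>ixs\<close> enumerates \<open>IX\<close> in the order of the recursion
      of \<open>lvalues\<close>. Thus \<open>lvalues\<close> is a \<open>map\<close> over a filtered
      list, and \<open>distinct\<close> becomes injectivity.\<close>
    define ixs where "ixs = (\<lambda>G' :: (bool list \<times> bool list \<times> bool list list) list.
      concat (map (\<lambda>(z1, z2, ws). map (\<lambda>(w, f). ((z1, z2, ws), w, f)) (List.product ws Fl)) G'))"
    have fs: "lquads m x F = map (\<lambda>(a, b). lquad m a b x) F" for F
      by (induction F) auto
    have scaled: "lscaled m d u fs = map (\<lambda>f. tl (lmul m (ladd f u) d)) fs" for d u fs
      by (induction fs) auto
    have shifted: "lshifted m (linv m (ldelta m z1 z2)) x (lquads m x Fl) ws' =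
        map (\<lambda>p. tl (val x p)) (map (\<lambda>(w, f). ((z1, z2, ws), w, f)) (List.product ws' Fl))" for z1 z2 ws ws'
      by (induction ws') (auto simp: val_def fs scaled case_prod_unfold)
    have "lvalues m x (lquads m x Fl) G' = map (\<lambda>p. tl (val x p)) (filter (on x) (ixs G'))" for G'
    proof (induction G')
      case Nil
      show ?case by (simp add: ixs_def)
    next
      case (Cons k G')
      obtain z1 z2 ws where k: "k = (z1, z2, ws)" by (metis prod.exhaust)
      have "filter (on x) (map (\<lambda>(w, f). ((z1, z2, ws), w, f)) (List.product ws Fl)) =
          (if x \<in> set (lline m z1 z2) then map (\<lambda>(w, f). ((z1, z2, ws), w, f)) (List.product ws Fl) else [])"
        by (auto simp: filter_map o_def on_def case_prod_unfold)
      moreover have "ixs (k # G') = map (\<lambda>(w, f). ((z1, z2, ws), w, f)) (List.product ws Fl) @ ixs G'"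
        by (simp add: ixs_def k)
      ultimately show ?case
        using Cons shifted[of z1 z2 ws ws] by (simp add: k)
    qed
    moreover have "distinct (lvalues m x (lquads m x Fl) G)"
    proof -
      have "values_ok m xs Fl G \<longleftrightarrow>
          (\<forall>x\<in>set xs. x = lzero m \<or> distinct (lvalues m x (lquads m x Fl) G))" for xs
        by (induction xs) auto
      thus ?thesis
        using vals x by auto
    qed
    ultimately have inj: "inj_on (\<lambda>p. tl (val x p)) (set (filter (on x) (ixs G)))"
      by (simp add: distinct_map)
    have "set (ixs G) = IX"
      by (force simp: ixs_def IX_def)
    thus ?thesis
      using pq inj_onD[OF inj, of p q] by simp
  qed
  have ev_val: "ev (val (x :: bool list) ((z1, z2, ws), w, a, b)) =
      quad (ev (ladd a (lsquare m w))) (ev (ladd b w)) (ev x) / delta (ev z1) (ev z2)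
      \<and> length (val x ((z1, z2, ws), w, a, b)) = length m"
    if "((z1, z2, ws), w, a, b) \<in> IX" "x \<in> set Wl" for x z1 z2 ws w a b
  proof -
    have k: "(z1, z2, ws) \<in> set G" "w \<in> set ws" "(a, b) \<in> set Fl"
      using that(1) by (auto simp: IX_def)
    hence len: "length z1 = length m" "length z2 = length m" "length w = length m" "length x = length m"
      using Gl(2)[OF k(1)] Wl(1) that(2) by auto
    have "ev (val x ((z1, z2, ws), w, a, b)) =
        (quad (ev a) (ev b) (ev x) + delta (ev w) (ev x)) * inverse (delta (ev z1) (ev z2))"
      using len Gl(2)[OF k(1)] by (simp add: val_def ev_def leval_linv)
    thus ?thesis
      using len by (simp add: ev_def quad_coeff_add val_def field_class.field_divide_inverse
          power2_eq_square flip: quad_square)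
  qed
  have I_inj': "p = q" if p: "p \<in> IX" "p = ((z1, z2, ws), w, a, b)" and q: "q \<in> IX" "q = ((y1, y2, ws'), w', a', b')"
    and x: "x \<in> set (lline m z1 z2)" "x \<in> set (lline m y1 y2)" "x \<noteq> lzero m"
    and eq: "quad (ev (ladd a (lsquare m w))) (ev (ladd b w)) (ev x) / delta (ev z1) (ev z2) +
      quad (ev (ladd a' (lsquare m w'))) (ev (ladd b' w')) (ev x) / delta (ev y1) (ev y2) \<in> {0, 1}"
    for p q x z1 z2 ws w a b y1 y2 ws' w' a' b'
  proof -
    have "z1 \<in> set Wl" "z2 \<in> set Wl"
      using p Gl(2) by (auto simp: IX_def)
    hence xW: "x \<in> set Wl"
      using x(1) Wl(2,5) by (auto simp: lline_def)
    note v = ev_val[OF p(1)[unfolded p(2)] xW] ev_val[OF q(1)[unfolded q(2)] xW]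
    have len: "length (val x p) = length m" "length (val x q) = length m"
      using v by (simp_all add: p(2) q(2))
    \<comment> \<open>A difference of 1 is the addition of \<open>lone m\<close>, which alters only
      the constant coefficient dropped by \<open>tl\<close>.\<close>
    have "ev (val x p) = ev (val x q) \<or> ev (val x p) = ev (ladd (lone m) (val x q))"
      using eq v by (auto simp: p(2) q(2) ev_def ac_add_eq_iff)
    hence "val x p = val x q \<or> val x p = ladd (lone m) (val x q)"
      using leval_inject[OF len] leval_inject[OF len(1), of "ladd (lone m) (val x q)"] len(2)
      unfolding ev_def by (simp del: leval_ladd)
    moreover have "tl (ladd (lone m) r) = tl r" if "length r = length m" for r
      using that length_m by (cases r; cases m) (auto simp: lone_def ladd_lzero)
    ultimately have "tl (val x p) = tl (val x q)"
      using len(2) by auto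
    thus "p = q"
      using vals_inj[OF xW x(3) p(1) q(1)] x(1,2) by (simp add: on_def p(2) q(2))
  qed
  \<comment> \<open>Equal images have value difference 0 over z1, a nonzero point of their common
    line, so \<open>I_inj'\<close> at x = z1 identifies the indices.\<close>
  have "inj_on iI IX"
  proof (rule inj_onI)
    fix p q assume pq: "p \<in> IX" "q \<in> IX" "iI p = iI q"
    obtain z1 z2 ws w a b where p: "p = ((z1, z2, ws), w, a, b)" by (metis prod.exhaust)
    obtain y1 y2 ws' w' a' b' where q: "q = ((y1, y2, ws'), w', a', b')" by (metis prod.exhaust)
    have k: "z1 \<in> set Wl" "z2 \<in> set Wl" "y1 \<in> set Wl" "y2 \<in> set Wl" "ldelta m z1 z2 \<noteq> lzero m"
      using pq Gl(2) by (auto simp: IX_def p q)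
    have eq: "ev z1 = ev y1" "ev z2 = ev y2" "ev (ladd a (lsquare m w)) = ev (ladd a' (lsquare m w'))"
        "ev (ladd b w) = ev (ladd b' w')"
      using pq(3) by (auto simp: p q iI_def)
    have yz: "y1 = z1" "y2 = z2"
      using eq(1,2) k Wl(1) leval_inject by (auto simp: ev_def)
    have "z1 \<noteq> lzero m"
    proof
      assume "z1 = lzero m"
      hence "leval g (ldelta m z1 z2) = 0"
        using k Wl(1) by simp
      thus False
        using k Wl(1) leval_eq_0_iff[of "ldelta m z1 z2"] by simp
    qed
    thus "p = q"
      using eq by (intro I_inj'[OF pq(1) p pq(2) q, of z1]) (auto simp: yz lline_def)
  qed
  hence "card I = card IX"
    unfolding I_def by (rule card_image)
  also have "\<dots> = (\<Sum>k\<in>set G. length (snd (snd k)) * length Fl)"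
  proof -
    have "card IX = (\<Sum>k\<in>set G. card ((case k of (z1, z2, ws) \<Rightarrow> set ws) \<times> set Fl))"
      unfolding IX_def by (subst card_SigmaI[symmetric]) (auto simp: case_prod_unfold)
    also have "\<dots> = (\<Sum>k\<in>set G. length (snd (snd k)) * length Fl)"
      using Gl(2) distinct_Fl
      by (intro sum.cong) (auto simp: card_cartesian_product distinct_card)
    finally show ?thesis .
  qed
  also have "\<dots> = length Fl * (\<Sum>(z1, z2, ws)\<leftarrow>G. length ws)"
    using Gl(1) by (simp add: sum_list_distinct_conv_sum_set case_prod_unfold sum_distrib_left mult.commute)
  finally have card_entries: "card I = length Fl * (\<Sum>(z1, z2, ws)\<leftarrow>G. length ws)" .

  interpret exchange n d W C Q I
  proof
    show "Q \<subseteq> GF2 d \<times> (GF2 d - {0})"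
    proof -
      have *: "qQ (w, a, b) \<in> GF2 d \<times> (GF2 d - {0})" if "w \<in> set Wl" "(a, b) \<in> set Fl" for w a b
        using evE b_plus_w[OF that(2,1)] leval_eq_0_iff[of "ladd b w"] Wl(1)[OF that(1)] Fl(1)[OF that(2)]
        by (simp add: qQ_def ev_def del: leval_ladd)
      show ?thesis
        unfolding Q_def
      proof (rule image_subsetI)
        fix y assume y: "y \<in> set Wl \<times> set Fl"
        obtain w a b where "y = (w, a, b)" by (metis prod.exhaust)
        thus "qQ y \<in> GF2 d \<times> (GF2 d - {0})"
          using *[of w a b] y by simp
      qed
    qed
    show "\<alpha> = \<alpha>' \<and> \<beta> = \<beta>'" if q: "(\<alpha>, \<beta>) \<in> Q" "(\<alpha>', \<beta>') \<in> Q" "\<alpha> * \<beta>' = \<alpha>' * \<beta>" for \<alpha> \<beta> \<alpha>' \<beta>'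
    proof -
      obtain w a b where w: "w \<in> set Wl" "(a, b) \<in> set Fl" "\<alpha> = ev (ladd a (lsquare m w))" "\<beta> = ev (ladd b w)"
        using q(1) by (auto simp: Q_def qQ_def)
      obtain w' a' b' where w': "w' \<in> set Wl" "(a', b') \<in> set Fl" "\<alpha>' = ev (ladd a' (lsquare m w'))"
          "\<beta>' = ev (ladd b' w')"
        using q(2) by (auto simp: Q_def qQ_def)
      have "(w, a, b) = (w', a', b')"
        by (rule Q_inj'[OF w(1) w'(1) w(2) w'(2) q(3)[unfolded w(3,4) w'(3,4)]])
      thus ?thesis
        by (simp add: w w')
    qed
    show "I \<subseteq> W \<times> W \<times> GF2 d \<times> GF2 d"
      using Gl(2) evE by (auto simp: I_def IX_def iI_def W_def)
    show "delta z1 z2 \<noteq> 0" if i: "(z1, z2, a, b) \<in> I" for z1 z2 a b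
    proof -
      obtain y1 y2 ws where k: "(y1, y2, ws) \<in> set G" "z1 = ev y1" "z2 = ev y2"
        using i by (auto simp: I_def IX_def iI_def)
      thus ?thesis
        using Gl(2)[OF k(1)] Wl(1) leval_eq_0_iff[of "ldelta m y1 y2"] by (simp add: ev_def)
    qed
    show "(a + z ^ 2, b + z) \<in> Q" if i: "(z1, z2, a, b) \<in> I" "z \<in> line z1 z2" for z1 z2 a b z
    proof -
      obtain y1 y2 ws w a' b' where k: "(y1, y2, ws) \<in> set G" "w \<in> set ws" "(a', b') \<in> set Fl"
          "z1 = ev y1" "z2 = ev y2" "a = ev (ladd a' (lsquare m w))" "b = ev (ladd b' w)"
        using i(1) by (auto simp: I_def IX_def iI_def)
      obtain y where y: "y \<in> set (lline m y1 y2)" "z = ev y"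
        using i(2) leval_lline[of y1 y2] by (auto simp: k ev_def)
      have mem: "y1 \<in> set Wl" "y2 \<in> set Wl" "w \<in> set Wl"
        using k(2) Gl(2)[OF k(1)] by auto
      hence "y \<in> set Wl"
        using y(1) Wl(2,5) by (auto simp: lline_def)
      hence wy: "ladd w y \<in> set Wl" "length w = length m" "length y = length m"
        using mem Wl(1,5) by auto
      \<comment> \<open>As z comes from W and squaring is additive, shifting by w and then by z is a
        single shift by an element of W.\<close>
      have "qQ (ladd w y, a', b') \<in> Q"
        unfolding Q_def using wy(1) k(3) by blast
      moreover have "qQ (ladd w y, a', b') = (a + z ^ 2, b + z)"
        using wy by (simp add: qQ_def k y ev_def ac_power2_add add.assoc)
      ultimately show ?thesis by simp
    qed
    show "(z1, z2, a, b) = (y1, y2, a', b')"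
      if I: "(z1, z2, a, b) \<in> I" "(y1, y2, a', b') \<in> I" and x: "x \<in> line z1 z2" "x \<in> line y1 y2" "x \<noteq> 0"
        and eq: "quad a b x / delta z1 z2 + quad a' b' x / delta y1 y2 \<in> {0, 1}"
      for z1 z2 a b y1 y2 a' b' x
    proof -
      obtain p where p': "p \<in> IX" "iI p = (z1, z2, a, b)" using I(1) unfolding I_def by force
      obtain q where q': "q \<in> IX" "iI q = (y1, y2, a', b')" using I(2) unfolding I_def by force
      obtain u1 u2 ws w c e where p: "p = ((u1, u2, ws), w, c, e)" by (metis prod.exhaust)
      obtain v1 v2 ws' w' c' e' where q: "q = ((v1, v2, ws'), w', c', e')" by (metis prod.exhaust)
      have uv: "u1 \<in> set Wl" "u2 \<in> set Wl" "v1 \<in> set Wl" "v2 \<in> set Wl"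
        using p' q' Gl(2) by (auto simp: IX_def p q)
      obtain s where s: "s \<in> set (lline m u1 u2)" "x = ev s"
        using x(1) p'(2) leval_lline[of u1 u2] by (auto simp: p iI_def ev_def)
      obtain t where t: "t \<in> set (lline m v1 v2)" "x = ev t"
        using x(2) q'(2) leval_lline[of v1 v2] by (auto simp: q iI_def ev_def)
      have "s = t"
        using s(2) t(2) leval_inject[OF length_lline[OF Wl(1)[OF uv(1)] Wl(1)[OF uv(2)] s(1)]
            length_lline[OF Wl(1)[OF uv(3)] Wl(1)[OF uv(4)] t(1)]] by (simp add: ev_def)
      moreover have "s \<noteq> lzero m"
        using s(2) x(3) by (auto simp: ev_def)
      ultimately have "p = q"
        using s t p' q' eq by (intro I_inj'[OF p'(1) p q'(1) q, of s]) (auto simp: p q iI_def)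
      thus ?thesis using p' q' by simp
    qed
    show "card I \<ge> 2"
      using two card_entries by simp
    show "W \<subseteq> GF2 d"
      using evE by (auto simp: W_def)
  qed (use d n C W0 W_add card_W in auto)

  have "real (card C) * 2 ^ d = 2 ^ (n - d) * 2 ^ d"
  proof -
    have "d \<le> n"
      using n dvd_imp_le by (auto simp: d_def)
    thus ?thesis
      using C(6) by (metis (mono_tags) le_add_diff_inverse2 of_nat_mult of_nat_numeral of_nat_power power_add)
  qed
  hence card_C: "real (card C) = 2 ^ (n - d)"
    by simp
  have sub_W: "module.subspace ac_scale W"
    unfolding bit_subspace_iff[OF vector_space_ac_scale] using W0 W_add by blast
  show ?thesis
  proof (intro exI conjI)
    show "W \<subseteq> GF2 n"
      using W_sub E_sub by blast
    show "module.subspace ac_scale W" by fact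
    show "vector_space.dim ac_scale W = 3"
      by (rule dim_eqI_card[OF vector_space_ac_scale sub_W]) (simp add: card_W)
    show "is_subspace_code pair_scale (W \<times> GF2 n) (n + 3) (card idx) 4 3 (plane ` idx)"
      by (rule is_subspace_code_planes)
    show "invariant_under (Sigma_grp n) (plane ` idx)"
      by (rule invariant_planes)
    show "real (card idx) = 2 ^ (2 * n) + real (length Fl) *
        (real (\<Sum>(z1, z2, ws)\<leftarrow>G. length ws) - 8) * 2 ^ (n - length m) * (2 ^ n - 1)"
      unfolding card_idx card_entries card_Q card_C by (simp add: d_def algebra_simps)
  qed
qed

end

section \<open>Evaluation of the certificates and the resulting codes\<close>

lemma checks4:
  "is_field_modulus modulus4" "W_ok modulus4 W4" "F_ok modulus4 W4 F4" "G_ok modulus4 W4 G4"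
  "values_ok modulus4 W4 F4 G4" "length modulus4 = 4" "length F4 = 1"
  "(\<Sum>(z1, z2, ws)\<leftarrow>G4. length ws) = 11"
  by code_simp+

lemma checks8:
  "W_ok modulus8 W8" "G_ok modulus8 W8 G8" "length modulus8 = 8" "length F8 = 9"
  "(\<Sum>(z1, z2, ws)\<leftarrow>G8. length ws) = 14"
  by code_simp+

lemma is_field_modulus8: "is_field_modulus modulus8"
  by code_simp

text \<open>There are 72 ratios, distinct among the 256 field elements.\<close>

lemma F_ok8: "F_ok modulus8 W8 F8"
  by code_simp

text \<open>Each nonzero x lies on three lines; with two cosets and nine maps this makes 54 values,
  distinct among the 128 classes modulo {0, 1}.\<close>

lemma values_ok8: "values_ok modulus8 W8 F8 G8"
  by code_simp

lemma exists_code4: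
  assumes "4 dvd n" "n > 0"
  shows "\<exists>W M C. W \<subseteq> GF2 n \<and> module.subspace ac_scale W \<and> vector_space.dim ac_scale W = 3 \<and>
    is_subspace_code pair_scale (W \<times> GF2 n) (n + 3) M 4 3 C \<and> invariant_under (Sigma_grp n) C \<and>
    real M = 2 ^ (2 * n) + 3 * 2 ^ (n - 4) * (2 ^ n - 1)"
proof -
  obtain g where "g ^ length modulus4 = leval g modulus4"
    using exists_modulus_root[of modulus4] checks4(6) by force
  then interpret list_field modulus4 g
    using checks4(1) by unfold_locales
  show ?thesis
    using exchange_code[OF checks4(2-5), of n] assms unfolding checks4(6-8) by simp
qed

lemma exists_code8:
  assumes "8 dvd n" "n > 0"
  shows "\<exists>W M C. W \<subseteq> GF2 n \<and> module.subspace ac_scale W \<and> vector_space.dim ac_scale W = 3 \<and>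
    is_subspace_code pair_scale (W \<times> GF2 n) (n + 3) M 4 3 C \<and> invariant_under (Sigma_grp n) C \<and>
    real M = 2 ^ (2 * n) + 54 * 2 ^ (n - 8) * (2 ^ n - 1)"
proof -
  obtain g where "g ^ length modulus8 = leval g modulus8"
    using exists_modulus_root[of modulus8] checks8(3) by force
  then interpret list_field modulus8 g
    using is_field_modulus8 by unfold_locales
  show ?thesis
    using exchange_code[OF checks8(1) F_ok8 checks8(2) values_ok8, of n] assms unfolding checks8(3-5)
    by simp
qed

text \<open>With t = 2^(n-4) the left side is (3 t - 3/8) (16 t - 1) and the right side 3 t (16 t -
  1): the constant 9/8 is the limiting ratio, and the surplus is 3/8 (2^n - 1).\<close>

lemma gain4:
  assumes "n \<ge> 4"
  shows "9 / 8 * gauss_binom_2 n \<le> 3 * 2 ^ (n - 4) * (2 ^ n - 1)"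
proof -
  obtain k where k: "n = k + 4"
    using assms by (metis le_add_diff_inverse2)
  define t :: real where "t = 2 ^ k"
  have t: "t \<ge> 1"
    unfolding t_def by simp
  have eq: "(2 :: real) ^ n = 16 * t" "(2 :: real) ^ (n - 1) = 8 * t" "(2 :: real) ^ (n - 4) = t"
    by (simp_all add: k t_def power_add)
  have "3 * t * (16 * t - 1) - 9 / 8 * ((16 * t - 1) * (8 * t - 1) / 3) = 3 / 8 * (16 * t - 1)"
    by (simp add: field_simps)
  moreover have "3 / 8 * (16 * t - 1) \<ge> 0"
    using t by simp
  ultimately show ?thesis
    unfolding gauss_binom_2_def eq by linarith
qed

text \<open>With t = 2^(n-8) the left side is (54 t - 27/64) (256 t - 1) and the right side 54 t
  (256 t - 1), so 81/64 is again the limiting ratio.\<close>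

lemma gain8:
  assumes "n \<ge> 8"
  shows "81 / 64 * gauss_binom_2 n \<le> 54 * 2 ^ (n - 8) * (2 ^ n - 1)"
proof -
  obtain k where k: "n = k + 8"
    using assms by (metis le_add_diff_inverse2)
  define t :: real where "t = 2 ^ k"
  have t: "t \<ge> 1"
    unfolding t_def by simp
  have eq: "(2 :: real) ^ n = 256 * t" "(2 :: real) ^ (n - 1) = 128 * t" "(2 :: real) ^ (n - 8) = t"
    by (simp_all add: k t_def power_add)
  have "54 * t * (256 * t - 1) - 81 / 64 * ((256 * t - 1) * (128 * t - 1) / 3) = 27 / 64 * (256 * t - 1)"
    by (simp add: field_simps)
  moreover have "27 / 64 * (256 * t - 1) \<ge> 0"
    using t by simp
  ultimately show ?thesis
    unfolding gauss_binom_2_def eq by linarith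
qed

theorem mainTheorem1:
  fixes v :: nat
  assumes "v > 0"
  shows
    "(v mod 8 = 7 \<longrightarrow>
        (\<exists>W M C.
           W \<subseteq> GF2 (v - 3) \<and> module.subspace ac_scale W \<and> vector_space.dim ac_scale W = 3 \<and>
           is_subspace_code pair_scale (W \<times> GF2 (v - 3)) v M 4 3 C \<and>
           invariant_under (Sigma_grp (v - 3)) C \<and>
           real M \<ge> 2 ^ (2 * (v - 3)) + 9 / 8 * gauss_binom_2 (v - 3)) \<and>
        real (A2 v 4 3) \<ge> 2 ^ (2 * (v - 3)) + 9 / 8 * gauss_binom_2 (v - 3)) \<and>
     (v mod 8 = 3 \<and> v \<ge> 11 \<longrightarrow>
        (\<exists>W M C.
           W \<subseteq> GF2 (v - 3) \<and> module.subspace ac_scale W \<and> vector_space.dim ac_scale W = 3 \<and>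
           is_subspace_code pair_scale (W \<times> GF2 (v - 3)) v M 4 3 C \<and>
           invariant_under (Sigma_grp (v - 3)) C \<and>
           real M \<ge> 2 ^ (2 * (v - 3)) + 81 / 64 * gauss_binom_2 (v - 3)) \<and>
        real (A2 v 4 3) \<ge> 2 ^ (2 * (v - 3)) + 81 / 64 * gauss_binom_2 (v - 3))"
proof (intro conjI impI; (elim conjE)?)
  assume v: "v mod 8 = 7"
  \<comment> \<open>Here n is 4 modulo 8, so the field of order 16 lies in
    \<open>GF2 (v - 3)\<close>.\<close>
  have n: "4 dvd v - 3" "v - 3 > 0" "v - 3 \<ge> 4" "v - 3 + 3 = v"
    using v by presburger+
  obtain W M C where *: "W \<subseteq> GF2 (v - 3)" "module.subspace ac_scale W" "vector_space.dim ac_scale W = 3"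
    "is_subspace_code pair_scale (W \<times> GF2 (v - 3)) v M 4 3 C" "invariant_under (Sigma_grp (v - 3)) C"
    "real M = 2 ^ (2 * (v - 3)) + 3 * 2 ^ (v - 3 - 4) * (2 ^ (v - 3) - 1)"
    using exists_code4[OF n(1,2)] unfolding n(4) by blast
  have M: "real M \<ge> 2 ^ (2 * (v - 3)) + 9 / 8 * gauss_binom_2 (v - 3)"
    using gain4[OF n(3)] unfolding *(6) by linarith
  show "\<exists>W M C. W \<subseteq> GF2 (v - 3) \<and> module.subspace ac_scale W \<and> vector_space.dim ac_scale W = 3 \<and>
      is_subspace_code pair_scale (W \<times> GF2 (v - 3)) v M 4 3 C \<and>
      invariant_under (Sigma_grp (v - 3)) C \<and>
      real M \<ge> 2 ^ (2 * (v - 3)) + 9 / 8 * gauss_binom_2 (v - 3)"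
    using * M by blast
  show "real (A2 v 4 3) \<ge> 2 ^ (2 * (v - 3)) + 9 / 8 * gauss_binom_2 (v - 3)"
    using M A2_ge[OF vector_space_pair_scale *(4)] by linarith
next
  assume v: "v mod 8 = 3" "v \<ge> 11"
  \<comment> \<open>Here 8 divides n, and \<open>v \<ge> 11\<close> rules out n = 0, so the field of
    order 256 lies in \<open>GF2 (v - 3)\<close>.\<close>
  have n: "8 dvd v - 3" "v - 3 > 0" "v - 3 \<ge> 8" "v - 3 + 3 = v"
    using v by presburger+
  obtain W M C where *: "W \<subseteq> GF2 (v - 3)" "module.subspace ac_scale W" "vector_space.dim ac_scale W = 3"
    "is_subspace_code pair_scale (W \<times> GF2 (v - 3)) v M 4 3 C" "invariant_under (Sigma_grp (v - 3)) C"
    "real M = 2 ^ (2 * (v - 3)) + 54 * 2 ^ (v - 3 - 8) * (2 ^ (v - 3) - 1)"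
    using exists_code8[OF n(1,2)] unfolding n(4) by blast
  have M: "real M \<ge> 2 ^ (2 * (v - 3)) + 81 / 64 * gauss_binom_2 (v - 3)"
    using gain8[OF n(3)] unfolding *(6) by linarith
  show "\<exists>W M C. W \<subseteq> GF2 (v - 3) \<and> module.subspace ac_scale W \<and> vector_space.dim ac_scale W = 3 \<and>
      is_subspace_code pair_scale (W \<times> GF2 (v - 3)) v M 4 3 C \<and>
      invariant_under (Sigma_grp (v - 3)) C \<and>
      real M \<ge> 2 ^ (2 * (v - 3)) + 81 / 64 * gauss_binom_2 (v - 3)"
    using * M by blast
  show "real (A2 v 4 3) \<ge> 2 ^ (2 * (v - 3)) + 81 / 64 * gauss_binom_2 (v - 3)"
    using M A2_ge[OF vector_space_pair_scale *(4)] by linarith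
qed

end
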